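(* The deformation space of the ideal quartz framework is given by a three-dimensional torus $(S^1)^3$ minus the degenerate cases in which the span of the four period vectors is less than three-dimensional. Explicitly: let $T$ be the set of pairs $(R_0,R_1)$ of orthogonal $3\times 3$ matrices with $-R_0,-R_1\in SO(3)$ for which the four vectors $$p_1=R_0e_3-\bigl(e_1+R_1(e_2-e_1)\bigr),\quad p_2=e_3-\bigl(e_1+R_1(e_3-e_1)\bigr),\quad p_3=R_0e_2-e_2,\quad p_4=e_1-R_1e_1-R_0e_1$$ satisfy $p_1+p_2+p_3+p_4=0$. Then $T$ is diffeomorphic to $(S^1)^3$, and the deformation space of the ideal quartz framework is $T$ minus the set of those $(R_0,R_1)\in T$ for which $\dim \mathrm{span}(p_1,p_2,p_3,p_4)<3$.
   Context: Periodic frameworks and deformations. A 3-periodic bar-and-joint framework is an infinite graph with a free action of a free abelian group $\Gamma$ of rank 3 (with finitely many orbits of vertices and edges), realized in $\mathbb{R}^3$ so that $\Gamma$ acts on the vertices by a rank 3 lattice of translations (the periodicity lattice). A deformation keeps all edge lengths fixed and keeps the framework periodic under the abstract group $\Gamma$, but the lattice of translations representing $\Gamma$ may vary (it must remain of rank 3). Deformations are considered modulo Euclidean motions. No condition of non-self-collision is imposed. The ideal quartz framework. It consists of congruent regular tetrahedra (all six edges of each tetrahedron are bars), each vertex being shared by exactly two tetrahedra. Modulo $\Gamma$ there are three tetrahedra, represented by: - $A_0A_1A_2A_3$; - $A_0B_1B_2B_3$, sharing the vertex $A_0$ with the first; - $C_0A_1C_2C_3$, sharing the vertex $A_1$ with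 the first. The full framework is obtained by translating these three tetrahedra by all periods. The group $\Gamma$ is generated by four periods, represented by the vectors $p_1=B_3-C_2$, $p_2=A_3-C_3$, $p_3=B_2-A_2$, $p_4=C_0-B_1$, subject to the single relation that their sum is zero. This relation must be maintained under deformation. Parametrization. Equivalence under Euclidean motions is eliminated by keeping the regular tetrahedron $A_0A_1A_2A_3$ fixed. Put $e_i=A_i-A_0$ for $i=1,2,3$. The positions of the other two tetrahedra are given by orthogonal transformations $R_0,R_1$: $R_0$ (acting with center $A_0$) fixes $A_0$ and takes $A_i$ to $B_i$ for $i\neq 0$; $R_1$ (acting with center $A_1$) fixes $A_1$ and takes $A_j$ to $C_j$ for $j\neq 1$. In the quartz framework both $R_0$ and $R_1$ are orientation reversing, i.e. $-R_0,-R_1\in SO(3)$, and this is part of the definition of the configurations considered. With these notations the four period vectors have the expressions $p_1,\dots,p_4$ in terms of $R_0,R_1,e_1,e_2,e_3$ displayed in the claim. The deformation space is the space of all such configurations $(R_0,R_1)$ for which the zero-sum relation holds and the four period vectors span $\mathbb{R}^3$. *)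

theory Defs
  imports "HOL-Analysis.Analysis"
begin

section \<open>Smooth maps between subsets of Euclidean spaces\<close>

text \<open>In finite dimension and for open \<open>U\<close>, the following says that \<open>f\<close> is of class \<open>C\<^sup>k\<close> on
  \<open>U\<close>: all iterated directional derivatives up to order \<open>k\<close> exist (as Frechet derivatives applied
  to fixed vectors) and are continuous.\<close>

primrec Ck_on :: "nat \<Rightarrow> 'a::euclidean_space set \<Rightarrow> ('a \<Rightarrow> 'b::euclidean_space) \<Rightarrow> bool" where
  "Ck_on 0 U f \<longleftrightarrow> continuous_on U f"
| "Ck_on (Suc k) U f \<longleftrightarrow>
     (\<forall>x\<in>U. f differentiable (at x)) \<and>
     (\<forall>v. Ck_on k U (\<lambda>x. frechet_derivative f (at x) v))"

text \<open>Maps on an arbitrary subset of a Euclidean space are smooth if they extend locally to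
  smooth maps on open sets.  A set diffeomorphic in this sense to an embedded submanifold, such as
  a product of circles, is itself an embedded submanifold, and the diffeomorphism is one of
  manifolds.\<close>

definition smooth_map_on :: "'a::euclidean_space set \<Rightarrow> ('a \<Rightarrow> 'b::euclidean_space) \<Rightarrow> bool" where
  "smooth_map_on X f \<longleftrightarrow>
     (\<forall>x\<in>X. \<exists>U F. open U \<and> x \<in> U \<and> (\<forall>k. Ck_on k U F) \<and> (\<forall>y\<in>U \<inter> X. F y = f y))"

definition diffeomorphic :: "'a::euclidean_space set \<Rightarrow> 'b::euclidean_space set \<Rightarrow> bool" where
  "diffeomorphic X Y \<longleftrightarrow>
     (\<exists>f g. smooth_map_on X f \<and> smooth_map_on Y g \<and> f ` X = Y \<and> g ` Y = X \<and>
            (\<forall>x\<in>X. g (f x) = x) \<and> (\<forall>y\<in>Y. f (g y) = y))"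

section \<open>Periodic placements and Euclidean motions\<close>

text \<open>The abstract periodicity group \<open>\<Gamma>\<close> is \<open>\<int>\<^sup>3\<close>.  In \<open>periodic_placement\<close>, \<open>\<Gamma>\<close> has rank 3, so an
  additive \<open>\<pi>\<close> whose range spans the space is automatically injective with a discrete image: its
  image is a lattice of translations of rank 3.  The lattice is not prescribed.\<close>

type_synonym period = "int ^ 3"

definition periodic_placement :: "(period \<Rightarrow> 'v \<Rightarrow> 'v) \<Rightarrow> ('v \<Rightarrow> real ^ 3) \<Rightarrow> bool" where
  "periodic_placement act p \<longleftrightarrow>
     (\<exists>\<pi>. Modules.additive \<pi> \<and> span (range \<pi>) = UNIV \<and> (\<forall>g v. p (act g v) = p v + \<pi> g))"

definition congruence :: "(('v \<Rightarrow> real ^ 3) \<times> ('v \<Rightarrow> real ^ 3)) set" where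
  "congruence = {(p, q). \<exists>f. (\<forall>x y. dist (f x) (f y) = dist x y) \<and> q = f \<circ> p}"

section \<open>The quartz framework\<close>

text \<open>\<open>\<Gamma>\<close> is generated by \<open>\<gamma>\<^sub>1, \<dots>, \<gamma>\<^sub>4\<close> with \<open>\<gamma>\<^sub>1 + \<gamma>\<^sub>2 + \<gamma>\<^sub>3 + \<gamma>\<^sub>4 = 0\<close> as only relation.\<close>

definition gamma1 :: period where "gamma1 = axis 1 1"
definition gamma2 :: period where "gamma2 = axis 2 1"
definition gamma3 :: period where "gamma3 = axis 3 1"
definition gamma4 :: period where "gamma4 = - (gamma1 + gamma2 + gamma3)"

text \<open>Each vertex lies in exactly two tetrahedra, so there are six vertex orbits; they are
  represented by \<open>A\<^sub>0, A\<^sub>1, A\<^sub>2, A\<^sub>3, B\<^sub>1, C\<^sub>2\<close>.  The other corners of the three tetrahedra are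
  \<open>B\<^sub>3 = \<gamma>\<^sub>1 C\<^sub>2\<close>, \<open>A\<^sub>3 = \<gamma>\<^sub>2 C\<^sub>3\<close>, \<open>B\<^sub>2 = \<gamma>\<^sub>3 A\<^sub>2\<close>, \<open>C\<^sub>0 = \<gamma>\<^sub>4 B\<^sub>1\<close>.\<close>

datatype quartz_orbit = OA0 | OA1 | OA2 | OA3 | OB1 | OC2

type_synonym quartz_vertex = "quartz_orbit \<times> period"

definition translate :: "period \<Rightarrow> quartz_vertex \<Rightarrow> quartz_vertex" where
  "translate g v = (fst v, g + snd v)"

text \<open>\<open>A\<^sub>0A\<^sub>1A\<^sub>2A\<^sub>3\<close>, \<open>A\<^sub>0B\<^sub>1B\<^sub>2B\<^sub>3\<close> and \<open>C\<^sub>0A\<^sub>1C\<^sub>2C\<^sub>3\<close>, in this order of corners.\<close>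

definition tetA :: "quartz_vertex list" where
  "tetA = [(OA0, 0), (OA1, 0), (OA2, 0), (OA3, 0)]"

definition tetB :: "quartz_vertex list" where
  "tetB = [(OA0, 0), (OB1, 0), (OA2, gamma3), (OC2, gamma1)]"

definition tetC :: "quartz_vertex list" where
  "tetC = [(OB1, gamma4), (OA1, 0), (OC2, 0), (OA3, - gamma2)]"

definition quartz_bars :: "quartz_vertex set set" where
  "quartz_bars = {{translate g x, translate g y} | g x y.
     \<exists>t\<in>{tetA, tetB, tetC}. x \<in> set t \<and> y \<in> set t \<and> x \<noteq> y}"

definition moves_tetrahedra ::
    "real ^ 3 ^ 3 \<Rightarrow> real ^ 3 ^ 3 \<Rightarrow> (quartz_vertex \<Rightarrow> real ^ 3) \<Rightarrow> bool" where
  "moves_tetrahedra R0 R1 p \<longleftrightarrow>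
     (\<forall>i<4. p (tetB ! i) = p (tetA ! 0) + R0 *v (p (tetA ! i) - p (tetA ! 0))) \<and>
     (\<forall>j<4. p (tetC ! j) = p (tetA ! 1) + R1 *v (p (tetA ! j) - p (tetA ! 1)))"

text \<open>Periodic placements of the framework in which all bars have length \<open>a\<close> and the second and
  third tetrahedra are images of the first one under orientation reversing transformations.\<close>

definition quartz_placements :: "real \<Rightarrow> (quartz_vertex \<Rightarrow> real ^ 3) set" where
  "quartz_placements a =
     {p. periodic_placement translate p \<and>
         (\<forall>u v. {u, v} \<in> quartz_bars \<longrightarrow> dist (p u) (p v) = a) \<and>
         (\<exists>R0 R1. rotation_matrix (- R0) \<and> rotation_matrix (- R1) \<and> moves_tetrahedra R0 R1 p)}"

text \<open>The quotient topology on congruence classes, where placements carry the topology of pointwise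
  convergence.\<close>

definition quartz_deformation_space :: "real \<Rightarrow> (quartz_vertex \<Rightarrow> real ^ 3) set topology" where
  "quartz_deformation_space a =
     topology (\<lambda>W. W \<subseteq> quartz_placements a // congruence \<and>
                   openin (top_of_set (quartz_placements a)) (\<Union>W))"

section \<open>The parametrization by orthogonal matrices\<close>

definition regular_tetrahedron :: "real \<Rightarrow> (nat \<Rightarrow> real ^ 3) \<Rightarrow> bool" where
  "regular_tetrahedron a A \<longleftrightarrow> a > 0 \<and> (\<forall>i<4. \<forall>j<4. i \<noteq> j \<longrightarrow> dist (A i) (A j) = a)"

definition period_vectors ::
    "(nat \<Rightarrow> real ^ 3) \<Rightarrow> real ^ 3 ^ 3 \<Rightarrow> real ^ 3 ^ 3 \<Rightarrow> (real ^ 3) list" where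
  "period_vectors e R0 R1 =
     [R0 *v e 3 - (e 1 + R1 *v (e 2 - e 1)),
      e 3 - (e 1 + R1 *v (e 3 - e 1)),
      R0 *v e 2 - e 2,
      e 1 - R1 *v e 1 - R0 *v e 1]"

definition quartz_T :: "(nat \<Rightarrow> real ^ 3) \<Rightarrow> ((real ^ 3 ^ 3) \<times> (real ^ 3 ^ 3)) set" where
  "quartz_T e = {(R0, R1). rotation_matrix (- R0) \<and> rotation_matrix (- R1) \<and>
                           sum_list (period_vectors e R0 R1) = 0}"

definition quartz_degenerate :: "(nat \<Rightarrow> real ^ 3) \<Rightarrow> ((real ^ 3 ^ 3) \<times> (real ^ 3 ^ 3)) set" where
  "quartz_degenerate e =
     {(R0, R1) \<in> quartz_T e. dim (span (set (period_vectors e R0 R1))) < 3}"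

end

theory Submission
  imports Defs
begin

text \<open>The edge vectors \<open>e\<^sub>1, e\<^sub>2, e\<^sub>3\<close> of a regular tetrahedron with edge \<open>a\<close> are face diagonals of a
  cube with side \<open>a / \<surd>2\<close>.  Up to the factor \<open>c = a \<surd>2\<close>, the vectors \<open>e\<^sub>2 + e\<^sub>3 - e\<^sub>1\<close>,
  \<open>e\<^sub>1 + e\<^sub>3 - e\<^sub>2\<close>, \<open>e\<^sub>1 + e\<^sub>2 - e\<^sub>3\<close> are therefore an orthonormal frame \<open>E\<^sub>1, E\<^sub>2, E\<^sub>3\<close>
  (\<open>orthogonal_matrix_cube_frame\<close>).  In the sum of the four period vectors all terms collect to
  \<open>c (R\<^sub>0 E\<^sub>1 - R\<^sub>1 E\<^sub>1 - E\<^sub>3)\<close>.  Hence, for the rotations \<open>Q\<^sub>0 = - R\<^sub>0\<close> and \<open>Q\<^sub>1 = - R\<^sub>1\<close> written in this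
  frame, the zero-sum relation says \<open>Q\<^sub>1 E\<^sub>1 - Q\<^sub>0 E\<^sub>1 = E\<^sub>3\<close> (\<open>quartz_T_iff_linked_rotations\<close>).

  Two unit vectors with difference \<open>E\<^sub>3\<close> span an equilateral triangle with it, so they are
  \<open>(r x, r y, \<plusminus> 1/2)\<close> with \<open>r = \<surd>3 / 2\<close> and \<open>(x, y)\<close> on the unit circle: this is the first circle
  factor.  A rotation with prescribed value at \<open>E\<^sub>1\<close> is determined up to a preceding rotation about
  \<open>E\<^sub>1\<close>, which gives one more circle for \<open>Q\<^sub>0\<close> and one for \<open>Q\<^sub>1\<close>.  The bundle is globally trivial
  because the vector \<open>(r x, r y, h)\<close> can be completed to an oriented orthonormal frame whose entries
  are affine functions of \<open>(x, y)\<close> (\<open>tilted_frame_decomposition\<close>).  With this choice both the parametrization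
  of \<open>T\<close> by the torus and its inverse are restrictions of polynomial maps between the ambient vector
  spaces, so smoothness amounts to smoothness of polynomials (\<open>smooth_map_on_polynomial_function\<close>).

  For the deformation space, every placement has a unique congruent copy whose first tetrahedron is
  \<open>A\<close>, and that copy is determined by its pair \<open>(R\<^sub>0, R\<^sub>1)\<close>, because the vertices are obtained from
  \<open>A\<close> by \<open>R\<^sub>0\<close> and \<open>R\<^sub>1\<close> and the lattice is generated by the period vectors (\<open>placement_unique\<close>).
  The pair can be read off from any placement by a formula that is invariant under congruence and
  continuous for pointwise convergence: it compares the cube frames of the three tetrahedra
  (\<open>relative_orientations\<close>).  Thus the space of placements modulo congruence has both a continuous
  section and a continuous invariant inverting it, which is enough to identify the
  quotient topology (\<open>homeomorphic_map_quotient_section\<close>).\<close>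

section \<open>Polynomial maps are smooth\<close>

text \<open>Polynomials are closed under directional differentiation, so that \<open>Ck_on\<close> can be derived for all
  orders by induction.\<close>

lemma real_polynomial_function_frechet_derivative:
  fixes f :: "'a::real_normed_vector \<Rightarrow> real"
  assumes "real_polynomial_function f"
  shows "real_polynomial_function (\<lambda>x. frechet_derivative f (at x) v)"
  using assms
proof (induction f rule: real_polynomial_function.induct)
  case (linear f)
  then have "frechet_derivative f (at x) = f" for x
    by (metis frechet_derivative_at bounded_linear_imp_has_derivative)
  then show ?case by (simp add: real_polynomial_function.intros(2))
next
  case (const c)
  show ?case by (simp add: real_polynomial_function.intros(2))
next
  case (add f g)
  then have "(f has_derivative frechet_derivative f (at x)) (at x)"
      "(g has_derivative frechet_derivative g (at x)) (at x)" for x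
    by (auto simp: frechet_derivative_works [symmetric] differentiable_at_real_polynomial_function)
  from frechet_derivative_at [OF has_derivative_add [OF this]]
  have "frechet_derivative (\<lambda>x. f x + g x) (at x) v
      = frechet_derivative f (at x) v + frechet_derivative g (at x) v" for x
    by (rule fun_cong [OF sym])
  with add show ?case by (simp add: real_polynomial_function.intros(3))
next
  case (mult f g)
  then have "(f has_derivative frechet_derivative f (at x)) (at x)"
      "(g has_derivative frechet_derivative g (at x)) (at x)" for x
    by (auto simp: frechet_derivative_works [symmetric] differentiable_at_real_polynomial_function)
  from frechet_derivative_at [OF has_derivative_mult [OF this]]
  have "frechet_derivative (\<lambda>x. f x * g x) (at x) v
      = f x * frechet_derivative g (at x) v + frechet_derivative f (at x) v * g x" for x
    by (rule fun_cong [OF sym])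
  with mult show ?case
    by (simp add: real_polynomial_function.intros(3) real_polynomial_function.intros(4))
qed

lemma polynomial_function_frechet_derivative:
  fixes p :: "'a::euclidean_space \<Rightarrow> 'b::euclidean_space"
  assumes "polynomial_function p"
  shows "polynomial_function (\<lambda>x. frechet_derivative p (at x) v)"
  unfolding polynomial_function_iff_Basis_inner
proof
  fix b :: 'b assume "b \<in> Basis"
  have "p differentiable at x" for x
    by (rule differentiable_at_polynomial_function [OF assms])
  then have "((\<lambda>x. p x \<bullet> b) has_derivative (\<lambda>v. frechet_derivative p (at x) v \<bullet> b)) (at x)" for x
    by (auto intro!: derivative_eq_intros frechet_derivative_works [THEN iffD1])
  then have "frechet_derivative p (at x) v \<bullet> b = frechet_derivative (\<lambda>x. p x \<bullet> b) (at x) v" for x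
    by (metis frechet_derivative_at)
  moreover have "real_polynomial_function (\<lambda>x. p x \<bullet> b)"
    using assms \<open>b \<in> Basis\<close> by (simp add: polynomial_function_iff_Basis_inner)
  ultimately show "real_polynomial_function (\<lambda>x. frechet_derivative p (at x) v \<bullet> b)"
    by (simp add: real_polynomial_function_frechet_derivative)
qed

lemma Ck_on_polynomial_function:
  fixes p :: "'a::euclidean_space \<Rightarrow> 'b::euclidean_space"
  assumes "polynomial_function p"
  shows "Ck_on k U p"
  using assms
proof (induction k arbitrary: p)
  case 0
  then show ?case by (simp add: continuous_on_polymonial_function)
next
  case (Suc k)
  then show ?case
    by (simp add: differentiable_at_polynomial_function polynomial_function_frechet_derivative)
qed

text \<open>A polynomial map is its own smooth extension, on every subset.  The circles, the torus and
  \<open>T\<close> therefore need no charts.\<close>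

lemma smooth_map_on_polynomial_function:
  "polynomial_function f \<Longrightarrow> smooth_map_on X f"
  unfolding smooth_map_on_def using Ck_on_polynomial_function open_UNIV by blast

text \<open>The remaining closure properties allow polynomiality to be checked on real entries of matrices
  and on real and imaginary parts.\<close>

lemma polynomial_function_Pair:
  assumes "polynomial_function f" "polynomial_function g"
  shows "polynomial_function (\<lambda>x. (f x, g x))"
  unfolding polynomial_function_def
proof (intro allI impI)
  fix L :: "'b \<times> 'c \<Rightarrow> real" assume L: "bounded_linear L"
  have "bounded_linear (\<lambda>y. L (y, 0))" "bounded_linear (\<lambda>z. L (0, z))"
    by (intro bounded_linear_compose [OF L] bounded_linear_Pair bounded_linear_ident bounded_linear_zero)+
  with assms have "real_polynomial_function ((\<lambda>y. L (y, 0)) \<circ> f)"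
      "real_polynomial_function ((\<lambda>z. L (0, z)) \<circ> g)"
    by (simp_all only: polynomial_function_def)
  moreover have "L \<circ> (\<lambda>x. (f x, g x)) = (\<lambda>x. ((\<lambda>y. L (y, 0)) \<circ> f) x + ((\<lambda>z. L (0, z)) \<circ> g) x)"
    by (simp add: fun_eq_iff linear_add [OF bounded_linear.linear [OF L], symmetric])
  ultimately show "real_polynomial_function (L \<circ> (\<lambda>x. (f x, g x)))"
    by (simp only: real_polynomial_function.intros(3))
qed

lemma polynomial_function_Complex:
  assumes "real_polynomial_function f" "real_polynomial_function g"
  shows "polynomial_function (\<lambda>x. Complex (f x) (g x))"
  using assms by (simp add: polynomial_function_iff_Basis_inner Basis_complex_def inner_complex_def)

lemma polynomial_function_matrixI:
  fixes f :: "'a::real_normed_vector \<Rightarrow> real ^ 'n ^ 'm"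
  assumes "\<And>i j. real_polynomial_function (\<lambda>x. f x $ i $ j)"
  shows "polynomial_function f"
  using assms by (auto simp: polynomial_function_iff_Basis_inner Basis_vec_def inner_axis)

lemma polynomial_function_matrix_entry:
  fixes f :: "'a::real_normed_vector \<Rightarrow> real ^ 'n ^ 'm"
  assumes "polynomial_function f"
  shows "real_polynomial_function (\<lambda>x. f x $ i $ j)"
proof -
  have "bounded_linear (\<lambda>M::real ^ 'n ^ 'm. M $ i $ j)"
    by (intro bounded_linear_compose [OF bounded_linear_vec_nth] bounded_linear_vec_nth)
  with assms show ?thesis
    by (auto simp: polynomial_function_def o_def)
qed

lemma polynomial_function_matrix_mult:
  fixes f :: "'a::real_normed_vector \<Rightarrow> real ^ 'n ^ 'm" and g :: "'a \<Rightarrow> real ^ 'k ^ 'n"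
  assumes "polynomial_function f" "polynomial_function g"
  shows "polynomial_function (\<lambda>x. f x ** g x)"
  using assms
  by (intro polynomial_function_matrixI)
    (auto simp: matrix_matrix_mult_def
      intro!: real_polynomial_function_sum real_polynomial_function.intros(4) polynomial_function_matrix_entry)

lemma polynomial_function_transpose:
  fixes f :: "'a::real_normed_vector \<Rightarrow> real ^ 'n ^ 'm"
  assumes "polynomial_function f"
  shows "polynomial_function (\<lambda>x. transpose (f x))"
  using assms by (intro polynomial_function_matrixI)
    (auto simp: transpose_def intro!: polynomial_function_matrix_entry)

section \<open>Rotations with a prescribed image of the first axis\<close>

lemma rotation_matrix_conjugate:
  fixes F Q :: "real ^ 'n ^ 'n"
  assumes "orthogonal_matrix F"
  shows "rotation_matrix (F ** Q ** transpose F) \<longleftrightarrow> rotation_matrix Q"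
proof -
  have *: "rotation_matrix (F ** Q ** transpose F)"
    if "orthogonal_matrix F" "rotation_matrix Q" for F Q :: "real ^ 'n ^ 'n"
    using that det_orthogonal_matrix [OF that(1)]
    by (auto simp: rotation_matrix_def det_mul orthogonal_matrix_mul)
  have "transpose F ** (F ** Q ** transpose F) ** F = Q"
    using assms by (simp add: orthogonal_matrix_def matrix_mul_assoc [symmetric])
      (simp add: orthogonal_matrix_def matrix_mul_assoc)
  then show ?thesis
    using * [OF assms] * [of "transpose F" "F ** Q ** transpose F"] assms by auto
qed

lemma matrix_mult_minus:
  fixes A B :: "real ^ 'n ^ 'n"
  shows "(- A) ** B = - (A ** B)" "A ** (- B) = - (A ** B)"
  by (simp_all add: matrix_matrix_mult_def vec_eq_iff sum_negf)

lemma matrix_vector_mult_minus: "(- A) *v x = - (A *v (x :: real ^ 'n))"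
  by (simp add: matrix_vector_mult_def vec_eq_iff sum_negf)

definition axis_rotation :: "complex \<Rightarrow> real ^ 3 ^ 3" where
  "axis_rotation v = vector [vector [1, 0, 0], vector [0, Re v, - Im v], vector [0, Im v, Re v]]"

text \<open>A frame with first column \<open>(r x, r y, h)\<close> for \<open>z = x + i y\<close> and \<open>r = \<surd>3 / 2\<close>, where \<open>h = \<plusminus> 1/2\<close>.
  The second column is the horizontal unit vector \<open>(- y, x, 0)\<close>, always perpendicular to the first,
  and the third is the cross product of the two; all entries are affine functions of \<open>z\<close>.\<close>

definition tilted_frame :: "real \<Rightarrow> complex \<Rightarrow> real ^ 3 ^ 3" where
  "tilted_frame h z = vector [vector [sqrt 3 / 2 * Re z, - Im z, - h * Re z],
                              vector [sqrt 3 / 2 * Im z, Re z, - h * Im z],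
                              vector [h, 0, sqrt 3 / 2]]"

lemma orthogonal_matrix_3:
  fixes Q :: "real ^ 3 ^ 3"
  shows "orthogonal_matrix Q \<longleftrightarrow>
    (\<forall>i j. Q$1$i * Q$1$j + Q$2$i * Q$2$j + Q$3$i * Q$3$j = (if i = j then 1 else 0))"
  by (simp add: orthogonal_matrix vec_eq_iff matrix_matrix_mult_def transpose_def mat_def sum_3)

lemma norm_complex_eq_1_iff: "norm z = 1 \<longleftrightarrow> Re z * Re z + Im z * Im z = 1"
  by (simp add: cmod_def power2_eq_square)

lemma rotation_matrix_axis_rotation: "norm v = 1 \<Longrightarrow> rotation_matrix (axis_rotation v)"
  unfolding rotation_matrix_def norm_complex_eq_1_iff
  by (simp add: orthogonal_matrix_3 det_3 forall_3 axis_rotation_def vector_3 algebra_simps)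

lemma rotation_matrix_tilted_frame:
  assumes "norm z = 1" "h * h = 1 / 4"
  shows "rotation_matrix (tilted_frame h z)"
proof -
  define r :: real where "r = sqrt 3 / 2"
  have K: "tilted_frame h z = vector [vector [r * Re z, - Im z, - h * Re z],
      vector [r * Im z, Re z, - h * Im z], vector [h, 0, r]]"
    by (simp add: tilted_frame_def r_def)
  have z: "Re z * Re z + Im z * Im z = 1"
    using assms by (simp add: norm_complex_eq_1_iff)
  have r: "r * r + h * h = 1"
    using assms by (simp add: r_def)
  have "(r * Re z) * (r * Re z) + (r * Im z) * (r * Im z) + h * h = 1"
    "(h * Re z) * (h * Re z) + (h * Im z) * (h * Im z) + r * r = 1"
    "Im z * Im z + Re z * Re z = 1"
    "(r * Re z) * (h * Re z) + (r * Im z) * (h * Im z) = h * r"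
    using z r by algebra+
  then have "orthogonal_matrix (tilted_frame h z)"
    unfolding orthogonal_matrix_3 forall_3 K vector_3
    by (simp add: mult.commute)
  moreover have "det (tilted_frame h z) = 1"
    unfolding det_3 K vector_3
    using z r by algebra
  ultimately show ?thesis by (simp add: rotation_matrix_def)
qed

text \<open>Orthonormality and determinant one leave for the lower right block \<open>(p, q; s, t)\<close> the relation
  \<open>(p - t)\<^sup>2 + (q + s)\<^sup>2 = 1 + 1 - 2 = 0\<close>.\<close>

lemma rotation_fixing_first_axis:
  fixes N :: "real ^ 3 ^ 3"
  assumes "rotation_matrix N" "N$1$1 = 1" "N$2$1 = 0" "N$3$1 = 0"
  shows "N = axis_rotation (Complex (N$2$2) (N$3$2))" "norm (Complex (N$2$2) (N$3$2)) = 1"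
proof -
  have N: "N$1$i * N$1$j + N$2$i * N$2$j + N$3$i * N$3$j = (if i = j then 1 else 0)" for i j
    using assms by (simp add: rotation_matrix_def orthogonal_matrix_3)
  have row: "N$1$2 = 0" "N$1$3 = 0"
    using N [of 1 2] N [of 1 3] assms by auto
  have c2: "N$2$2 * N$2$2 + N$3$2 * N$3$2 = 1" and c3: "N$2$3 * N$2$3 + N$3$3 * N$3$3 = 1"
    using N [of 2 2] N [of 3 3] row by auto
  have d: "N$2$2 * N$3$3 - N$2$3 * N$3$2 = 1"
    using assms row by (simp add: rotation_matrix_def det_3)
  have "(N$2$2 - N$3$3)\<^sup>2 + (N$2$3 + N$3$2)\<^sup>2 = 0"
    using c2 c3 d by algebra
  then have "N$3$3 = N$2$2" "N$2$3 = - N$3$2"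
    by (simp_all add: sum_power2_eq_zero_iff)
  with row assms show "N = axis_rotation (Complex (N$2$2) (N$3$2))"
    by (simp add: vec_eq_iff forall_3 axis_rotation_def vector_3)
  show "norm (Complex (N$2$2) (N$3$2)) = 1"
    using c2 by (simp add: norm_complex_eq_1_iff)
qed

text \<open>These two functions recover \<open>z\<close> and \<open>v\<close> from \<open>tilted_frame h z ** axis_rotation v\<close>.  They are
  written as polynomials in the entries of the matrix.\<close>

definition tilt_direction :: "real ^ 3 ^ 3 \<Rightarrow> complex" where
  "tilt_direction Q = Complex (Q$1$1 / (sqrt 3 / 2)) (Q$2$1 / (sqrt 3 / 2))"

definition spin :: "real \<Rightarrow> real ^ 3 ^ 3 \<Rightarrow> complex" where
  "spin h Q = (let N = transpose (tilted_frame h (tilt_direction Q)) ** Q in Complex (N$2$2) (N$3$2))"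

lemma tilted_frame_coordinates:
  assumes "norm z = 1" "h * h = 1 / 4" "Q = tilted_frame h z ** axis_rotation v"
  shows "tilt_direction Q = z" "spin h Q = v" "Q$3$1 = h"
proof -
  show z: "tilt_direction Q = z" and "Q$3$1 = h"
    by (simp_all add: assms(3) tilt_direction_def matrix_matrix_mult_def sum_3 axis_rotation_def
        tilted_frame_def vector_3)
  have "transpose (tilted_frame h z) ** Q = axis_rotation v"
    using rotation_matrix_tilted_frame [OF assms(1,2)]
    by (simp add: assms(3) matrix_mul_assoc rotation_matrix_def orthogonal_matrix)
  then show "spin h Q = v"
    by (simp add: spin_def z axis_rotation_def vector_3)
qed

text \<open>The frame \<open>K = tilted_frame h z\<close> has the same first column as \<open>Q\<close>, so the rotation
  \<open>transpose K ** Q\<close> fixes the first axis.\<close>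

lemma tilted_frame_decomposition:
  assumes Q: "rotation_matrix Q" and h: "Q$3$1 = h" "h * h = 1 / 4"
  shows "norm (tilt_direction Q) = 1" "norm (spin h Q) = 1"
    "Q = tilted_frame h (tilt_direction Q) ** axis_rotation (spin h Q)"
proof -
  let ?z = "tilt_direction Q" and ?K = "tilted_frame h (tilt_direction Q)"
  let ?N = "transpose ?K ** Q"
  have *: "Q$1$1 * Q$1$1 + Q$2$1 * Q$2$1 + Q$3$1 * Q$3$1 = 1"
    using Q by (simp add: rotation_matrix_def orthogonal_matrix_3)
  have Q1: "Q$1$1 = sqrt 3 / 2 * Re ?z" "Q$2$1 = sqrt 3 / 2 * Im ?z"
    by (simp_all add: tilt_direction_def)
  have "3 / 4 * (Re ?z * Re ?z + Im ?z * Im ?z) = (sqrt 3 / 2 * Re ?z) * (sqrt 3 / 2 * Re ?z)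
      + (sqrt 3 / 2 * Im ?z) * (sqrt 3 / 2 * Im ?z)"
    by (simp add: algebra_simps)
  also have "\<dots> = 3 / 4"
    using * h unfolding Q1 by simp
  finally show z: "norm ?z = 1"
    by (simp add: norm_complex_eq_1_iff)
  have K: "rotation_matrix ?K"
    by (rule rotation_matrix_tilted_frame [OF z h(2)])
  have "Q$1$1 = ?K$1$1" "Q$2$1 = ?K$2$1" "Q$3$1 = ?K$3$1"
    using h(1) Q1 by (simp_all add: tilted_frame_def vector_3)
  then have "?N$i$1 = ?K$1$i * ?K$1$1 + ?K$2$i * ?K$2$1 + ?K$3$i * ?K$3$1" for i
    by (simp only: matrix_matrix_mult_def transpose_def vec_lambda_beta sum_3)
  then have N1: "?N$i$1 = (if i = 1 then 1 else 0)" for i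
    using K by (simp add: rotation_matrix_def orthogonal_matrix_3)
  have "rotation_matrix ?N"
    using K Q by (simp add: rotation_matrix_def orthogonal_matrix_mul det_mul)
  from rotation_fixing_first_axis [OF this] N1
  have N: "?N = axis_rotation (spin h Q)" and "norm (spin h Q) = 1"
    by (simp_all add: spin_def Let_def)
  then show "norm (spin h Q) = 1" by simp
  have "?K ** ?N = Q"
    using K by (simp add: matrix_mul_assoc rotation_matrix_def orthogonal_matrix_def)
  then show "Q = ?K ** axis_rotation (spin h Q)"
    by (simp add: N)
qed

section \<open>Pairs of rotations linked along the first axis form a torus\<close>

definition linked_rotations :: "((real ^ 3 ^ 3) \<times> (real ^ 3 ^ 3)) set" where
  "linked_rotations = {(Q0, Q1). rotation_matrix Q0 \<and> rotation_matrix Q1 \<and>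
     Q1 *v axis 1 1 - Q0 *v axis 1 1 = axis 3 1}"

text \<open>If \<open>u\<close> and \<open>u + E\<^sub>3\<close> are both unit vectors, then \<open>1 = 1 + 2 u\<^sub>3 + 1\<close>, hence \<open>u\<^sub>3 = - 1/2\<close>.  The
  horizontal parts agree and give a common direction on the circle.\<close>

lemma linked_rotations_iff:
  "(Q0, Q1) \<in> linked_rotations \<longleftrightarrow> rotation_matrix Q0 \<and> rotation_matrix Q1 \<and>
     tilt_direction Q0 = tilt_direction Q1 \<and> Q0$3$1 = - 1 / 2 \<and> Q1$3$1 = 1 / 2"
proof (cases "rotation_matrix Q0 \<and> rotation_matrix Q1")
  case True
  then have "Q$1$1 * Q$1$1 + Q$2$1 * Q$2$1 + Q$3$1 * Q$3$1 = 1" if "Q = Q0 \<or> Q = Q1" for Q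
    using that by (auto simp: rotation_matrix_def orthogonal_matrix_3)
  from this [of Q0] this [of Q1]
  have "Q0$3$1 = - 1 / 2" if "Q0$1$1 = Q1$1$1" "Q0$2$1 = Q1$2$1" "Q1$3$1 - Q0$3$1 = 1"
    using that by (simp, algebra)
  then have "(Q1$1$1 - Q0$1$1 = 0 \<and> Q1$2$1 - Q0$2$1 = 0 \<and> Q1$3$1 - Q0$3$1 = 1) \<longleftrightarrow>
      (Q0$1$1 = Q1$1$1 \<and> Q0$2$1 = Q1$2$1 \<and> Q0$3$1 = - 1 / 2 \<and> Q1$3$1 = 1 / 2)"
    by auto
  moreover have "axis (3::3) (1::real) $ 1 = 0" "axis (3::3) (1::real) $ 2 = 0"
      "axis (3::3) (1::real) $ 3 = 1"
    by (simp_all add: axis_def)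
  ultimately show ?thesis
    using True by (simp add: linked_rotations_def matrix_vector_mult_basis column_def vec_eq_iff
        forall_3 tilt_direction_def)
qed (auto simp: linked_rotations_def)

definition torus_coordinates :: "(real ^ 3 ^ 3) \<times> (real ^ 3 ^ 3) \<Rightarrow> complex \<times> complex \<times> complex" where
  "torus_coordinates = (\<lambda>(Q0, Q1). (tilt_direction Q1, spin (- 1 / 2) Q0, spin (1 / 2) Q1))"

definition torus_parametrization :: "complex \<times> complex \<times> complex \<Rightarrow> (real ^ 3 ^ 3) \<times> (real ^ 3 ^ 3)" where
  "torus_parametrization = (\<lambda>(z, v, w).
     (tilted_frame (- 1 / 2) z ** axis_rotation v, tilted_frame (1 / 2) z ** axis_rotation w))"

abbreviation (input) torus3 :: "(complex \<times> complex \<times> complex) set" where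
  "torus3 \<equiv> sphere 0 1 \<times> sphere 0 1 \<times> sphere 0 1"

lemma torus_parametrization_inverse:
  assumes "t \<in> torus3"
  shows "torus_parametrization t \<in> linked_rotations" "torus_coordinates (torus_parametrization t) = t"
proof -
  obtain z v w where t: "t = (z, v, w)" "norm z = 1" "norm v = 1" "norm w = 1"
    using assms by (cases t) auto
  have h: "(- 1 / 2) * (- 1 / 2) = 1 / (4::real)" "(1 / 2) * (1 / 2) = 1 / (4::real)" by simp_all
  note r = tilted_frame_coordinates [OF t(2) h(1) refl, of v]
    tilted_frame_coordinates [OF t(2) h(2) refl, of w]
  have "rotation_matrix (tilted_frame (- 1 / 2) z ** axis_rotation v)"
    "rotation_matrix (tilted_frame (1 / 2) z ** axis_rotation w)"
    using rotation_matrix_tilted_frame [OF t(2)] rotation_matrix_axis_rotation [OF t(3)]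
      rotation_matrix_axis_rotation [OF t(4)] h
    by (auto simp: rotation_matrix_def orthogonal_matrix_mul det_mul)
  then show "torus_parametrization t \<in> linked_rotations"
    using r by (simp add: t(1) torus_parametrization_def linked_rotations_iff)
  show "torus_coordinates (torus_parametrization t) = t"
    using r by (simp add: t(1) torus_parametrization_def torus_coordinates_def)
qed

lemma torus_coordinates_inverse:
  assumes "Q \<in> linked_rotations"
  shows "torus_coordinates Q \<in> torus3" "torus_parametrization (torus_coordinates Q) = Q"
proof -
  obtain Q0 Q1 where Q: "Q = (Q0, Q1)" by (cases Q)
  have q: "rotation_matrix Q0" "rotation_matrix Q1" "tilt_direction Q0 = tilt_direction Q1"
      "Q0$3$1 = - 1 / 2" "Q1$3$1 = 1 / 2"
    using assms by (simp_all add: Q linked_rotations_iff)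
  note r = tilted_frame_decomposition [OF q(1) q(4)] tilted_frame_decomposition [OF q(2) q(5)]
  show "torus_coordinates Q \<in> torus3" "torus_parametrization (torus_coordinates Q) = Q"
    using r q(3) by (simp_all add: Q torus_coordinates_def torus_parametrization_def)
qed

lemma polynomial_function_tilted_frame:
  assumes "polynomial_function f"
  shows "polynomial_function (\<lambda>x. tilted_frame h (f x))"
proof -
  have "real_polynomial_function (\<lambda>x. Re (f x))" "real_polynomial_function (\<lambda>x. Im (f x))"
    using assms bounded_linear_Re bounded_linear_Im by (auto simp: polynomial_function_def o_def)
  then have "\<forall>i j. real_polynomial_function (\<lambda>x. tilted_frame h (f x) $ i $ j)"
    unfolding forall_3 tilted_frame_def vector_3
    by (auto intro!: real_polynomial_function.intros(2) real_polynomial_function.intros(4)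
        real_polynomial_function_minus real_polynomial_function_divide)
  then show ?thesis by (intro polynomial_function_matrixI) auto
qed

lemma polynomial_function_axis_rotation:
  assumes "polynomial_function f"
  shows "polynomial_function (\<lambda>x. axis_rotation (f x))"
proof -
  have "real_polynomial_function (\<lambda>x. Re (f x))" "real_polynomial_function (\<lambda>x. Im (f x))"
    using assms bounded_linear_Re bounded_linear_Im by (auto simp: polynomial_function_def o_def)
  then have "\<forall>i j. real_polynomial_function (\<lambda>x. axis_rotation (f x) $ i $ j)"
    unfolding forall_3 axis_rotation_def vector_3
    by (auto intro!: real_polynomial_function.intros(2) real_polynomial_function.intros(4)
        real_polynomial_function_minus real_polynomial_function_divide)
  then show ?thesis by (intro polynomial_function_matrixI) auto
qed

lemma polynomial_function_tilt_direction:
  "polynomial_function f \<Longrightarrow> polynomial_function (\<lambda>x. tilt_direction (f x))"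
  unfolding tilt_direction_def
  by (intro polynomial_function_Complex real_polynomial_function_divide polynomial_function_matrix_entry)

lemma polynomial_function_spin:
  "polynomial_function f \<Longrightarrow> polynomial_function (\<lambda>x. spin h (f x))"
  unfolding spin_def Let_def
  by (intro polynomial_function_Complex polynomial_function_matrix_entry polynomial_function_matrix_mult
      polynomial_function_transpose polynomial_function_tilted_frame polynomial_function_tilt_direction)

lemma polynomial_function_fst_snd:
  "polynomial_function fst" "polynomial_function snd" 
  by (simp_all add: polynomial_function_bounded_linear bounded_linear_fst bounded_linear_snd)

lemma polynomial_function_torus_coordinates: "polynomial_function torus_coordinates"
  unfolding torus_coordinates_def case_prod_beta
  by (intro polynomial_function_Pair polynomial_function_tilt_direction polynomial_function_spin
      polynomial_function_fst_snd)

lemma polynomial_function_torus_parametrization: "polynomial_function torus_parametrization"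
proof -
  have "polynomial_function (\<lambda>t::complex \<times> complex \<times> complex. fst (snd t))"
    "polynomial_function (\<lambda>t::complex \<times> complex \<times> complex. snd (snd t))"
    by (intro polynomial_function_bounded_linear bounded_linear_intros)+
  then show ?thesis
    unfolding torus_parametrization_def case_prod_beta
    by (intro polynomial_function_Pair polynomial_function_matrix_mult
        polynomial_function_tilted_frame polynomial_function_axis_rotation polynomial_function_fst_snd)
qed

section \<open>The cube around a regular tetrahedron\<close>

text \<open>The edge directions of the cube in which \<open>X\<^sub>0, \<dots>, X\<^sub>3\<close> are alternate corners, of unit length for a
  regular tetrahedron of edge \<open>a\<close>.\<close>

definition cube_axis :: "real \<Rightarrow> (nat \<Rightarrow> real ^ 3) \<Rightarrow> 3 \<Rightarrow> real ^ 3" where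
  "cube_axis a X j = (if j = 1 then X 2 + X 3 - X 1 - X 0
     else if j = 2 then X 1 + X 3 - X 2 - X 0 else X 1 + X 2 - X 3 - X 0) /\<^sub>R (a * sqrt 2)"

definition cube_frame :: "real \<Rightarrow> (nat \<Rightarrow> real ^ 3) \<Rightarrow> real ^ 3 ^ 3" where
  "cube_frame a X = (\<chi> i j. cube_axis a X j $ i)"

lemma cube_frame_mult_axis: "cube_frame a X *v axis j 1 = cube_axis a X j"
  by (simp add: cube_frame_def matrix_vector_mult_basis column_def vec_eq_iff)

lemma inner_edges_regular_tetrahedron:
  assumes "regular_tetrahedron a X" "i \<in> {1, 2, 3}" "j \<in> {1, 2, 3}"
  shows "(X i - X 0) \<bullet> (X j - X 0) = (if i = j then a\<^sup>2 else a\<^sup>2 / 2)"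
proof -
  have d: "norm (X i - X j) = a" if "i < 4" "j < 4" "i \<noteq> j" for i j
    using assms(1) that by (simp add: regular_tetrahedron_def dist_norm)
  have "norm (X i - X 0) = a" "norm (X j - X 0) = a"
    using assms(2,3) by (auto intro!: d)
  moreover have "norm (X i - X 0 - (X j - X 0)) = (if i = j then 0 else a)"
    using assms(2,3) d [of i j] by auto
  ultimately show ?thesis
    by (simp add: dot_norm_neg)
qed

lemma orthogonal_matrix_cube_frame:
  assumes "regular_tetrahedron a X"
  shows "orthogonal_matrix (cube_frame a X)"
proof -
  define e where "e i = X i - X 0" for i
  have a: "a > 0" using assms by (simp add: regular_tetrahedron_def)
  have e: "e 1 \<bullet> e 1 = a\<^sup>2" "e 2 \<bullet> e 2 = a\<^sup>2" "e 3 \<bullet> e 3 = a\<^sup>2" "e 1 \<bullet> e 2 = a\<^sup>2 / 2"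
    "e 1 \<bullet> e 3 = a\<^sup>2 / 2" "e 2 \<bullet> e 3 = a\<^sup>2 / 2" "e 2 \<bullet> e 1 = a\<^sup>2 / 2"
    "e 3 \<bullet> e 1 = a\<^sup>2 / 2" "e 3 \<bullet> e 2 = a\<^sup>2 / 2"
    unfolding e_def using inner_edges_regular_tetrahedron [OF assms] by simp_all
  \<comment> \<open>unscaled cube axes, all of squared length \<open>2 a\<^sup>2\<close>\<close>
  define n :: "3 \<Rightarrow> real ^ 3" where "n j = (if j = 1 then e 2 + e 3 - e 1
      else if j = 2 then e 1 + e 3 - e 2 else e 1 + e 2 - e 3)" for j
  have axes: "cube_axis a X j = n j /\<^sub>R (a * sqrt 2)" for j
    by (simp add: cube_axis_def n_def e_def)
  have n: "n i \<bullet> n j = (if i = j then 2 * a\<^sup>2 else 0)" for i j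
    using exhaust_3 [of i] exhaust_3 [of j]
    by (elim disjE) (simp_all add: n_def inner_add_left inner_add_right inner_diff_left
        inner_diff_right e del: One_nat_def)
  have "cube_axis a X i \<bullet> cube_axis a X j = n i \<bullet> n j / (2 * a\<^sup>2)" for i j
  proof -
    have "(a * sqrt 2) * (a * sqrt 2) = 2 * a\<^sup>2"
      by (simp add: power2_eq_square)
    then show ?thesis
      by (simp only: axes inner_scaleR_left inner_scaleR_right divide_inverse mult.assoc [symmetric]
          inverse_mult_distrib [symmetric] mult.commute [of "n i \<bullet> n j"])
  qed
  then have *: "cube_axis a X i \<bullet> cube_axis a X j = (if i = j then 1 else 0)" for i j
    using a unfolding n by simp
  have "(transpose (cube_frame a X) ** cube_frame a X) $ i $ j = cube_axis a X i \<bullet> cube_axis a X j" for i j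
    by (simp add: matrix_matrix_mult_def transpose_def cube_frame_def inner_vec_def)
  then show ?thesis
    by (simp add: * orthogonal_matrix mat_def vec_eq_iff)
qed

text \<open>Each cube axis is a combination of the corners with coefficient sum zero, so translations do not
  matter and a linear map acts by left multiplication.  This is how orientations are read off from
  vertex positions.\<close>

lemma cube_frame_affine:
  assumes "\<And>i. i < 4 \<Longrightarrow> Y i = y + M *v (X i - x)"
  shows "cube_frame a Y = M ** cube_frame a X"
proof -
  have "cube_axis a Y j = M *v cube_axis a X j" for j
    by (simp add: cube_axis_def assms matrix_vector_mult_scaleR algebra_simps)
  then show ?thesis
    by (simp add: cube_frame_def matrix_matrix_mult_def matrix_vector_mult_def vec_eq_iff)
qed

definition edge_coordinates :: "real \<Rightarrow> nat \<Rightarrow> real ^ 3" where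
  "edge_coordinates a i = (if i = 0 then 0 else (a * sqrt 2 / 2) *\<^sub>R
     (if i = 1 then axis 2 1 + axis 3 1 else if i = 2 then axis 1 1 + axis 3 1 else axis 1 1 + axis 2 1))"

text \<open>Conversely the cube frame determines the tetrahedron up to translation, since each edge is half the
  sum of two of the vectors \<open>e\<^sub>2 + e\<^sub>3 - e\<^sub>1\<close>, \<open>e\<^sub>1 + e\<^sub>3 - e\<^sub>2\<close>, \<open>e\<^sub>1 + e\<^sub>2 - e\<^sub>3\<close>.\<close>

lemma edge_eq_cube_frame:
  assumes "a > 0" "i < 4"
  shows "X i - X 0 = cube_frame a X *v edge_coordinates a i"
proof -
  have "i = 0 \<or> i = 1 \<or> i = 2 \<or> i = 3" using assms(2) by auto
  then show ?thesis
    using assms(1)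
    by (auto simp: edge_coordinates_def matrix_vector_mult_scaleR matrix_vector_right_distrib
        cube_frame_mult_axis cube_axis_def vec_eq_iff field_simps)
qed

section \<open>The zero-sum relation in cube coordinates\<close>

text \<open>The sign turns the orientation reversing \<open>R\<^sub>0, R\<^sub>1\<close> into rotations.\<close>

definition conjugate_pair :: "real ^ 3 ^ 3 \<Rightarrow> (real ^ 3 ^ 3) \<times> (real ^ 3 ^ 3) \<Rightarrow> (real ^ 3 ^ 3) \<times> (real ^ 3 ^ 3)" where
  "conjugate_pair F = (\<lambda>(R0, R1). (- (F ** R0 ** transpose F), - (F ** R1 ** transpose F)))"

lemma orthogonal_conjugate_inverse:
  fixes F Q :: "real ^ 'n ^ 'n"
  assumes "orthogonal_matrix F"
  shows "F ** (transpose F ** Q ** F) ** transpose F = Q"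
proof -
  have "F ** (transpose F ** Q ** F) ** transpose F = (F ** transpose F) ** Q ** (F ** transpose F)"
    by (simp only: matrix_mul_assoc)
  then show ?thesis
    using assms by (simp add: orthogonal_matrix_def)
qed

lemma conjugate_pair_inverse:
  assumes "orthogonal_matrix F"
  shows "conjugate_pair F (conjugate_pair (transpose F) R) = R"
    "conjugate_pair (transpose F) (conjugate_pair F R) = R"
proof -
  have "F ** (transpose F ** Q ** F) ** transpose F = Q" "transpose F ** (F ** Q ** transpose F) ** F = Q" for Q
    using orthogonal_conjugate_inverse [OF assms] orthogonal_conjugate_inverse [of "transpose F"] assms
    by simp_all
  then show "conjugate_pair F (conjugate_pair (transpose F) R) = R"
    "conjugate_pair (transpose F) (conjugate_pair F R) = R"
    by (simp_all add: conjugate_pair_def case_prod_beta matrix_mult_minus)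
qed

lemma sum_list_period_vectors:
  "sum_list (period_vectors e R0 R1) =
     R0 *v (e 2 + e 3 - e 1) - R1 *v (e 2 + e 3 - e 1) - (e 1 + e 2 - e 3)"
  by (simp add: period_vectors_def algebra_simps)

text \<open>Up to the factor \<open>a \<surd>2\<close>, the vectors \<open>e\<^sub>2 + e\<^sub>3 - e\<^sub>1\<close> and \<open>e\<^sub>1 + e\<^sub>2 - e\<^sub>3\<close> that occur in the sum of
  the periods are the first and the third cube axis.\<close>

lemma quartz_T_iff_linked_rotations:
  assumes A: "regular_tetrahedron a A" and e: "e = (\<lambda>i. A i - A 0)"
  shows "R \<in> quartz_T e \<longleftrightarrow> conjugate_pair (transpose (cube_frame a A)) R \<in> linked_rotations"
proof -
  obtain R0 R1 where R: "R = (R0, R1)" by (cases R)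
  define F where "F = cube_frame a A"
  have F: "orthogonal_matrix F" and a: "a > 0"
    using A orthogonal_matrix_cube_frame by (auto simp: F_def regular_tetrahedron_def)
  have FF: "transpose F *v (F *v x) = x" "F *v (transpose F *v x) = x" for x
    using F by (simp_all add: matrix_vector_mul_assoc orthogonal_matrix_def del: transpose_matrix_vector)
  have transpose_eq: "y = F *v x \<longleftrightarrow> transpose F *v y = x" for x y
    by (auto simp: FF simp del: transpose_matrix_vector)
  have s: "(a * sqrt 2) *\<^sub>R (x /\<^sub>R (a * sqrt 2)) = x" for x :: "real ^ 3"
    using a by (metis divideR_right mult_eq_0_iff order_less_irrefl real_sqrt_eq_0_iff zero_neq_numeral)
  have u: "e 2 + e 3 - e 1 = (a * sqrt 2) *\<^sub>R (F *v axis 1 1)" "e 1 + e 2 - e 3 = (a * sqrt 2) *\<^sub>R (F *v axis 3 1)"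
    unfolding F_def cube_frame_mult_axis cube_axis_def s by (simp_all add: e)
  have rot: "rotation_matrix (- (transpose F ** S ** F)) \<longleftrightarrow> rotation_matrix (- S)" for S
    using rotation_matrix_conjugate [of "transpose F" "- S"] F by (simp add: matrix_mult_minus)
  have "sum_list (period_vectors e R0 R1) = 0 \<longleftrightarrow>
      (a * sqrt 2) *\<^sub>R (R0 *v (F *v axis 1 1) - R1 *v (F *v axis 1 1) - F *v axis 3 1) = 0"
    by (simp only: sum_list_period_vectors u matrix_vector_mult_scaleR scaleR_diff_right)
  also have "\<dots> \<longleftrightarrow> R0 *v (F *v axis 1 1) - R1 *v (F *v axis 1 1) = F *v axis 3 1"
    using a by simp
  also have "\<dots> \<longleftrightarrow> transpose F *v (R0 *v (F *v axis 1 1) - R1 *v (F *v axis 1 1)) = axis 3 1"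
    by (rule transpose_eq)
  also have "\<dots> \<longleftrightarrow> - (transpose F ** R1 ** F) *v axis 1 1 - - (transpose F ** R0 ** F) *v axis 1 1 = axis 3 1"
    by (simp only: matrix_vector_mult_diff_distrib matrix_vector_mul_assoc matrix_mul_assoc
        matrix_vector_mult_minus minus_diff_minus minus_diff_eq)
  finally show ?thesis
    by (simp add: R quartz_T_def linked_rotations_def conjugate_pair_def rot flip: F_def)
qed

lemma polynomial_function_conjugate_pair:
  "polynomial_function (conjugate_pair F)"
  unfolding conjugate_pair_def case_prod_beta
  by (rule polynomial_function_Pair polynomial_function_minus polynomial_function_matrix_mult
      polynomial_function_const polynomial_function_fst_snd)+

lemma diffeomorphic_quartz_T_torus:
  assumes A: "regular_tetrahedron a A" and e: "e = (\<lambda>i. A i - A 0)"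
  shows "diffeomorphic (quartz_T e) torus3"
proof -
  define f where "f = torus_coordinates \<circ> conjugate_pair (transpose (cube_frame a A))"
  define g where "g = conjugate_pair (cube_frame a A) \<circ> torus_parametrization"
  note inv = conjugate_pair_inverse [OF orthogonal_matrix_cube_frame [OF A]]
  note T = quartz_T_iff_linked_rotations [OF A e]
  have f: "f R \<in> torus3" "g (f R) = R" if "R \<in> quartz_T e" for R
    using torus_coordinates_inverse [OF that [unfolded T]] by (simp_all add: f_def g_def inv)
  have g: "g t \<in> quartz_T e" "f (g t) = t" if "t \<in> torus3" for t
    unfolding T using torus_parametrization_inverse [OF that] by (simp_all add: f_def g_def inv)
  have "bij_betw f (quartz_T e) torus3" "bij_betw g torus3 (quartz_T e)"
    by (rule bij_betw_byWitness [where f' = g]; use f g in \<open>simp add: image_subset_iff\<close>)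
      (rule bij_betw_byWitness [where f' = f]; use f g in \<open>simp add: image_subset_iff\<close>)
  then have "f ` quartz_T e = torus3" "g ` torus3 = quartz_T e"
    by (simp_all only: bij_betw_imp_surj_on)
  moreover have "smooth_map_on (quartz_T e) f" "smooth_map_on torus3 g"
    unfolding f_def g_def
    by (rule smooth_map_on_polynomial_function polynomial_function_compose
        polynomial_function_torus_coordinates polynomial_function_torus_parametrization
        polynomial_function_conjugate_pair)+
  ultimately show ?thesis
    unfolding diffeomorphic_def using f(2) g(2) by (intro exI [of _ f] exI [of _ g]) simp
qed

section \<open>Congruence of placements\<close>

text \<open>Congruences are defined by arbitrary distance preserving maps; the matrix form is what lets them act
  on frames and on lattices.\<close>

lemma isometry_imp_affine:
  fixes f :: "real ^ 'n \<Rightarrow> real ^ 'n"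
  assumes "\<forall>x y. dist (f x) (f y) = dist x y"
  obtains t M where "orthogonal_matrix M" "\<And>x. f x = t + M *v x"
proof -
  have "orthogonal_transformation (\<lambda>x. f x - f 0)"
    using assms by (simp add: orthogonal_transformation_isometry dist_norm)
  then have *: "orthogonal_matrix (matrix (\<lambda>x. f x - f 0))" "linear (\<lambda>x. f x - f 0)"
    by (simp_all add: orthogonal_transformation_matrix)
  have "f x = f 0 + matrix (\<lambda>x. f x - f 0) *v x" for x
    using fun_cong [OF matrix_vector_mul(2) [OF *(2)], of x] by (simp add: algebra_simps)
  with * that show ?thesis by blast
qed

lemma orthogonal_matrix_dist:
  fixes M :: "real ^ 'n ^ 'n"
  assumes "orthogonal_matrix M"
  shows "dist (t + M *v x) (t + M *v y) = dist x y"
proof -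
  have "orthogonal_transformation ((*v) M)"
    using assms by (simp add: orthogonal_transformation_matrix)
  then show ?thesis
    by (simp add: dist_norm orthogonal_transformation_norm flip: matrix_vector_mult_diff_distrib)
qed

lemma congruence_iff_affine:
  "(p, q) \<in> congruence \<longleftrightarrow> (\<exists>t M. orthogonal_matrix M \<and> (\<forall>v. q v = t + M *v p v))"
proof
  assume "(p, q) \<in> congruence"
  then obtain f where f: "\<forall>x y. dist (f x) (f y) = dist x y" "q = f \<circ> p"
    unfolding congruence_def by blast
  from isometry_imp_affine [OF f(1)] obtain t M where "orthogonal_matrix M" "\<And>x. f x = t + M *v x"
    by blast
  with f(2) show "\<exists>t M. orthogonal_matrix M \<and> (\<forall>v. q v = t + M *v p v)"
    by auto
next
  assume "\<exists>t M. orthogonal_matrix M \<and> (\<forall>v. q v = t + M *v p v)"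
  then obtain t M where M: "orthogonal_matrix M" and q: "\<And>v. q v = t + M *v p v"
    by blast
  have "q = (\<lambda>x. t + M *v x) \<circ> p"
    by (simp add: q fun_eq_iff)
  moreover have "\<forall>x y. dist (t + M *v x) (t + M *v y) = dist x y"
    using orthogonal_matrix_dist [OF M] by blast
  ultimately show "(p, q) \<in> congruence"
    unfolding congruence_def by (intro CollectI case_prodI exI [of _ "\<lambda>x. t + M *v x"] conjI)
qed

lemma equiv_congruence: "equiv UNIV (congruence :: (('v \<Rightarrow> real ^ 3) \<times> _) set)"
proof (rule equivI)
  show "refl (congruence :: (('v \<Rightarrow> real ^ 3) \<times> _) set)"
    by (auto simp: refl_on_def congruence_def intro: exI [of _ id])
  show "sym (congruence :: (('v \<Rightarrow> real ^ 3) \<times> _) set)"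
  proof (rule symI)
    fix p q :: "'v \<Rightarrow> real ^ 3" assume "(p, q) \<in> congruence"
    then obtain t M where M: "orthogonal_matrix M" and q: "\<And>v. q v = t + M *v p v"
      unfolding congruence_iff_affine by blast
    have "p v = - (transpose M *v t) + transpose M *v q v" for v
      using M by (simp add: q matrix_vector_right_distrib matrix_vector_mul_assoc orthogonal_matrix_def
          del: transpose_matrix_vector)
    with M show "(q, p) \<in> congruence"
      unfolding congruence_iff_affine by (metis orthogonal_matrix_transpose)
  qed
  show "trans (congruence :: (('v \<Rightarrow> real ^ 3) \<times> _) set)"
  proof (rule transI)
    fix p q r :: "'v \<Rightarrow> real ^ 3" assume "(p, q) \<in> congruence" "(q, r) \<in> congruence"
    then obtain f g where "\<forall>x y. dist (f x) (f y) = dist x y" "q = f \<circ> p"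
        "\<forall>x y. dist (g x) (g y) = dist x y" "r = g \<circ> q"
      unfolding congruence_def by blast
    then have "\<forall>x y. dist ((g \<circ> f) x) ((g \<circ> f) y) = dist x y" "r = (g \<circ> f) \<circ> p"
      by auto
    then show "(p, r) \<in> congruence"
      unfolding congruence_def by blast
  qed
qed simp

section \<open>Periods and bars\<close>

lemma additive_scaleR_int:
  fixes \<pi> :: "period \<Rightarrow> real ^ 3"
  assumes "Modules.additive \<pi>"
  shows "\<pi> (axis j k) = of_int k *\<^sub>R \<pi> (axis j 1)"
proof -
  interpret Modules.additive \<pi> by fact
  have ax: "axis j (k + l) = axis j k + (axis j l :: period)" for k l
    by (simp add: axis_def vec_eq_iff)
  show ?thesis
  proof (induction k rule: int_induct [where k = 0])
    case base
    show ?case by (simp add: zero flip: zero_vec_def) (metis axis_eq_0_iff zero)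
  next
    case (step1 i)
    then show ?case by (simp add: ax add scaleR_left_distrib)
  next
    case (step2 i)
    then show ?case
      using add [of "axis j (i - 1)" "axis j 1"] by (simp add: ax [symmetric] scaleR_left_diff_distrib)
  qed
qed

lemma additive_period_eq:
  fixes \<pi> :: "period \<Rightarrow> real ^ 3"
  assumes "Modules.additive \<pi>"
  shows "\<pi> g = of_int (g$1) *\<^sub>R \<pi> gamma1 + of_int (g$2) *\<^sub>R \<pi> gamma2 + of_int (g$3) *\<^sub>R \<pi> gamma3"
proof -
  interpret Modules.additive \<pi> by fact
  have "g = axis 1 (g$1) + axis 2 (g$2) + axis 3 (g$3)"
    by (simp add: vec_eq_iff forall_3 axis_def)
  then have "\<pi> g = \<pi> (axis 1 (g$1)) + \<pi> (axis 2 (g$2)) + \<pi> (axis 3 (g$3))"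
    by (metis add)
  then show ?thesis
    by (simp only: gamma1_def gamma2_def gamma3_def additive_scaleR_int [OF assms, symmetric])
qed

text \<open>The rank condition on the lattice thus becomes a condition on four vectors, which will be the
  period vectors.\<close>

lemma span_range_additive_period:
  fixes \<pi> :: "period \<Rightarrow> real ^ 3"
  assumes "Modules.additive \<pi>"
  shows "span (range \<pi>) = span {\<pi> gamma1, \<pi> gamma2, \<pi> gamma3, \<pi> gamma4}" (is "_ = span ?S")
proof (rule span_eq [THEN iffD2], intro conjI subsetI)
  fix x assume "x \<in> range \<pi>"
  then obtain g where x: "x = \<pi> g" by blast
  show "x \<in> span ?S"
    unfolding x additive_period_eq [OF assms, of g]
    by (intro span_add span_scale span_base) simp_all
next
  fix x assume "x \<in> ?S"
  then show "x \<in> span (range \<pi>)" by (blast intro: span_base)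
qed

lemma All_less_4: "(\<forall>i<4. P i) \<longleftrightarrow> P 0 \<and> P (1::nat) \<and> P 2 \<and> P 3"
  by (auto simp: less_Suc_eq eval_nat_numeral)

lemma tet_nth:
  "tetA ! 0 = (OA0, 0)" "tetA ! 1 = (OA1, 0)" "tetA ! 2 = (OA2, 0)" "tetA ! 3 = (OA3, 0)"
  "tetB ! 0 = (OA0, 0)" "tetB ! 1 = (OB1, 0)" "tetB ! 2 = (OA2, gamma3)" "tetB ! 3 = (OC2, gamma1)"
  "tetC ! 0 = (OB1, gamma4)" "tetC ! 1 = (OA1, 0)" "tetC ! 2 = (OC2, 0)" "tetC ! 3 = (OA3, - gamma2)"
  by (simp_all add: tetA_def tetB_def tetC_def eval_nat_numeral)

lemma set_tet: "t \<in> {tetA, tetB, tetC} \<Longrightarrow> set t = (!) t ` {..<4}"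
  by (auto simp: tetA_def tetB_def tetC_def lessThan_Suc eval_nat_numeral)

text \<open>By periodicity only the bars of the three representative tetrahedra have to be checked.\<close>

lemma bars_of_length_iff:
  assumes p: "periodic_placement translate p"
  shows "(\<forall>u v. {u, v} \<in> quartz_bars \<longrightarrow> dist (p u) (p v) = a) \<longleftrightarrow>
    (\<forall>t\<in>{tetA, tetB, tetC}. \<forall>i<4. \<forall>j<4. t ! i \<noteq> t ! j \<longrightarrow> dist (p (t ! i)) (p (t ! j)) = a)"
    (is "?L \<longleftrightarrow> ?R")
proof
  assume L: ?L
  show ?R
  proof (intro ballI allI impI)
    fix t and i j :: nat assume t: "t \<in> {tetA, tetB, tetC}" "i < 4" "j < 4" "t ! i \<noteq> t ! j"
    have "translate 0 x = x" for x by (simp add: translate_def)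
    then have "{t ! i, t ! j} = {translate 0 (t ! i), translate 0 (t ! j)}" by simp
    moreover have "t ! i \<in> set t" "t ! j \<in> set t"
      using t set_tet [OF t(1)] by auto
    ultimately have "{t ! i, t ! j} \<in> quartz_bars"
      using t unfolding quartz_bars_def by blast
    with L show "dist (p (t ! i)) (p (t ! j)) = a" by blast
  qed
next
  assume R: ?R
  obtain \<pi> where \<pi>: "\<And>g v. p (translate g v) = p v + \<pi> g"
    using p unfolding periodic_placement_def by blast
  show ?L
  proof (intro allI impI)
    fix u v assume "{u, v} \<in> quartz_bars"
    then obtain g x y t where uv: "{u, v} = {translate g x, translate g y}"
      and t: "t \<in> {tetA, tetB, tetC}" and xy: "x \<in> set t" "y \<in> set t" "x \<noteq> y"
      unfolding quartz_bars_def by blast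
    obtain i j where "i < 4" "j < 4" "x = t ! i" "y = t ! j"
      using xy(1,2) unfolding set_tet [OF t] by blast
    with R t xy have "dist (p x) (p y) = a" by blast
    then have "dist (p (translate g x)) (p (translate g y)) = a"
      by (simp add: \<pi>)
    with uv show "dist (p u) (p v) = a"
      by (auto simp: doubleton_eq_iff dist_commute)
  qed
qed

lemma regular_tetrahedron_placement:
  assumes "a > 0" "p \<in> quartz_placements a"
  shows "regular_tetrahedron a (\<lambda>i. p (tetA ! i))"
proof -
  have R: "\<forall>i<4. \<forall>j<4. tetA ! i \<noteq> tetA ! j \<longrightarrow> dist (p (tetA ! i)) (p (tetA ! j)) = a"
    using assms(2) bars_of_length_iff by (auto simp: quartz_placements_def)
  have "tetA ! i \<noteq> tetA ! j" if "i < 4" "j < 4" "i \<noteq> j" for i j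
    using nth_eq_iff_index_eq [of tetA i j] that by (simp add: tetA_def)
  with R assms(1) show ?thesis
    by (simp add: regular_tetrahedron_def)
qed

lemma moves_tetrahedra_cube_frame:
  assumes "moves_tetrahedra R0 R1 p"
  shows "cube_frame a (\<lambda>i. p (tetB ! i)) = R0 ** cube_frame a (\<lambda>i. p (tetA ! i))"
    "cube_frame a (\<lambda>i. p (tetC ! i)) = R1 ** cube_frame a (\<lambda>i. p (tetA ! i))"
  using assms unfolding moves_tetrahedra_def by (blast intro: cube_frame_affine)+

lemma moves_tetrahedra_motion:
  assumes M: "orthogonal_matrix M" and q: "\<And>v. q v = t + M *v p v" and p: "moves_tetrahedra R0 R1 p"
  shows "moves_tetrahedra (M ** R0 ** transpose M) (M ** R1 ** transpose M) q"
proof -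
  have *: "(M ** R ** transpose M) *v (q u - q v) = M *v (R *v (p u - p v))" for R u v
  proof -
    have "(M ** R ** transpose M) *v (q u - q v) = (M ** R ** (transpose M ** M)) *v (p u - p v)"
      by (simp only: q add_diff_add diff_self add_0_left matrix_vector_mult_diff_distrib [symmetric]
          matrix_vector_mul_assoc matrix_mul_assoc)
    also have "\<dots> = M *v (R *v (p u - p v))"
      using M by (simp add: orthogonal_matrix_def matrix_vector_mul_assoc)
    finally show ?thesis .
  qed
  have "q x = q u + (M ** R ** transpose M) *v (q v - q u)"
    if "p x = p u + R *v (p v - p u)" for x u v R
    unfolding * by (simp add: q that matrix_vector_right_distrib)
  with p show ?thesis
    unfolding moves_tetrahedra_def by blast
qed

text \<open>Under a motion with linear part \<open>M\<close> the lattice is mapped by \<open>M\<close> and the transformations \<open>R\<^sub>0, R\<^sub>1\<close> are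
  conjugated by \<open>M\<close>, which preserves the orientation type even if \<open>M\<close> is a reflection.\<close>

lemma quartz_placements_congruent:
  assumes p: "p \<in> quartz_placements a" and "(p, q) \<in> congruence"
  shows "q \<in> quartz_placements a"
proof -
  obtain t M where M: "orthogonal_matrix M" and q: "\<And>v. q v = t + M *v p v"
    using assms(2) unfolding congruence_iff_affine by blast
  obtain \<pi> where \<pi>: "Modules.additive \<pi>" "span (range \<pi>) = UNIV" "\<And>g v. p (translate g v) = p v + \<pi> g"
    using p unfolding quartz_placements_def periodic_placement_def by blast
  have "Modules.additive (\<lambda>g. M *v \<pi> g)"
    using \<pi>(1) by (simp add: Modules.additive_def matrix_vector_right_distrib)
  moreover have "span (range (\<lambda>g. M *v \<pi> g)) = (*v) M ` span (range \<pi>)"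
    by (simp add: linear_span_image flip: image_image)
  moreover have "surj ((*v) M)"
  proof (rule surjI)
    show "M *v (transpose M *v x) = x" for x
      using M by (simp add: matrix_vector_mul_assoc orthogonal_matrix_def del: transpose_matrix_vector)
  qed
  moreover have "q (translate g v) = q v + M *v \<pi> g" for g v
    by (simp add: q \<pi>(3) matrix_vector_right_distrib)
  ultimately have "periodic_placement translate q"
    unfolding periodic_placement_def using \<pi>(2) by (intro exI [of _ "\<lambda>g. M *v \<pi> g"]) simp
  moreover have "dist (q u) (q v) = dist (p u) (p v)" for u v
    unfolding q by (rule orthogonal_matrix_dist [OF M])
  moreover obtain R0 R1 where R: "rotation_matrix (- R0)" "rotation_matrix (- R1)" "moves_tetrahedra R0 R1 p"
    using p unfolding quartz_placements_def by blast
  have "rotation_matrix (- (M ** R ** transpose M)) \<longleftrightarrow> rotation_matrix (- R)" for R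
    using rotation_matrix_conjugate [OF M, of "- R"] by (simp add: matrix_mult_minus)
  with R moves_tetrahedra_motion [OF M q R(3)]
  have "\<exists>R0 R1. rotation_matrix (- R0) \<and> rotation_matrix (- R1) \<and> moves_tetrahedra R0 R1 q"
    by blast
  ultimately show ?thesis
    using p by (simp add: quartz_placements_def)
qed

section \<open>The placement with given orientations\<close>

text \<open>Only the first three period vectors enter, since \<open>\<gamma>\<^sub>1, \<gamma>\<^sub>2, \<gamma>\<^sub>3\<close> is a basis of the period group; the
  fourth period vector is the image of \<open>\<gamma>\<^sub>4\<close> exactly when the zero-sum relation holds.\<close>

definition lattice_vector :: "(nat \<Rightarrow> real ^ 3) \<Rightarrow> real ^ 3 ^ 3 \<Rightarrow> real ^ 3 ^ 3 \<Rightarrow> period \<Rightarrow> real ^ 3" where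
  "lattice_vector e R0 R1 g = of_int (g$1) *\<^sub>R period_vectors e R0 R1 ! 0 +
     of_int (g$2) *\<^sub>R period_vectors e R0 R1 ! 1 + of_int (g$3) *\<^sub>R period_vectors e R0 R1 ! 2"

fun orbit_position :: "(nat \<Rightarrow> real ^ 3) \<Rightarrow> real ^ 3 ^ 3 \<Rightarrow> real ^ 3 ^ 3 \<Rightarrow> quartz_orbit \<Rightarrow> real ^ 3" where
  "orbit_position A R0 R1 OA0 = A 0"
| "orbit_position A R0 R1 OA1 = A 1"
| "orbit_position A R0 R1 OA2 = A 2"
| "orbit_position A R0 R1 OA3 = A 3"
| "orbit_position A R0 R1 OB1 = A 0 + R0 *v (A 1 - A 0)"
| "orbit_position A R0 R1 OC2 = A 1 + R1 *v (A 2 - A 1)"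

definition placement :: "(nat \<Rightarrow> real ^ 3) \<Rightarrow> (real ^ 3 ^ 3) \<times> (real ^ 3 ^ 3) \<Rightarrow> quartz_vertex \<Rightarrow> real ^ 3" where
  "placement A = (\<lambda>(R0, R1) (v, g).
     orbit_position A R0 R1 v + lattice_vector (\<lambda>i. A i - A 0) R0 R1 g)"

lemma lattice_vector_gamma:
  "lattice_vector e R0 R1 0 = 0"
  "lattice_vector e R0 R1 gamma1 = period_vectors e R0 R1 ! 0"
  "lattice_vector e R0 R1 gamma2 = period_vectors e R0 R1 ! 1"
  "lattice_vector e R0 R1 gamma3 = period_vectors e R0 R1 ! 2"
  "lattice_vector e R0 R1 (- g) = - lattice_vector e R0 R1 g"
  "lattice_vector e R0 R1 (g + h) = lattice_vector e R0 R1 g + lattice_vector e R0 R1 h"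
  by (simp_all add: lattice_vector_def gamma1_def gamma2_def gamma3_def axis_def scaleR_left_distrib)

lemma sum_list_period_vectors_nth:
  "sum_list (period_vectors e R0 R1) = period_vectors e R0 R1 ! 0 + period_vectors e R0 R1 ! 1 +
     period_vectors e R0 R1 ! 2 + period_vectors e R0 R1 ! 3"
proof -
  have "sum_list [a, b, c, d] = [a, b, c, d] ! 0 + [a, b, c, d] ! 1 + [a, b, c, d] ! 2 + [a, b, c, d] ! 3"
    for a b c d :: "real ^ 3"
    by (simp add: add.assoc)
  then show ?thesis
    unfolding period_vectors_def .
qed

lemma lattice_vector_gamma4:
  assumes "sum_list (period_vectors e R0 R1) = 0"
  shows "lattice_vector e R0 R1 gamma4 = period_vectors e R0 R1 ! 3"
  unfolding gamma4_def lattice_vector_gamma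
  by (rule minus_unique) (use assms sum_list_period_vectors_nth in simp)

lemma not_degenerate_iff:
  "(R0, R1) \<in> quartz_T e - quartz_degenerate e \<longleftrightarrow>
     (R0, R1) \<in> quartz_T e \<and> span (set (period_vectors e R0 R1)) = UNIV"
proof -
  have "dim (set (period_vectors e R0 R1)) \<le> 3"
    using dim_subset_UNIV [of "set (period_vectors e R0 R1)"] by simp
  moreover have "dim (set (period_vectors e R0 R1)) = 3 \<longleftrightarrow> span (set (period_vectors e R0 R1)) = UNIV"
    using dim_eq_full [of "set (period_vectors e R0 R1)"] by simp
  ultimately show ?thesis
    by (auto simp: quartz_degenerate_def)
qed

lemma set_period_vectors:
  "set (period_vectors e R0 R1) = {period_vectors e R0 R1 ! 0, period_vectors e R0 R1 ! 1,
     period_vectors e R0 R1 ! 2, period_vectors e R0 R1 ! 3}"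
  by (simp add: period_vectors_def eval_nat_numeral)

lemma placement_tetA: "i < 4 \<Longrightarrow> placement A R (tetA ! i) = A i"
  using All_less_4 [of "\<lambda>i. placement A R (tetA ! i) = A i"]
  by (simp add: tet_nth [unfolded One_nat_def] placement_def lattice_vector_gamma case_prod_beta)

text \<open>The only identification of corners that is not built into the positions is \<open>C\<^sub>0 = \<gamma>\<^sub>4 B\<^sub>1\<close>; it holds
  because of the zero-sum relation.\<close>

lemma moves_tetrahedra_placement:
  assumes "sum_list (period_vectors (\<lambda>i. A i - A 0) R0 R1) = 0"
  shows "moves_tetrahedra R0 R1 (placement A (R0, R1))"
  using lattice_vector_gamma4 [OF assms]
  unfolding moves_tetrahedra_def All_less_4 tet_nth
  by (simp add: placement_def lattice_vector_gamma period_vectors_def eval_nat_numeral algebra_simps)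

lemma placement_in_quartz_placements:
  assumes A: "regular_tetrahedron a A" and e: "e = (\<lambda>i. A i - A 0)"
    and R: "(R0, R1) \<in> quartz_T e - quartz_degenerate e"
  shows "placement A (R0, R1) \<in> quartz_placements a"
proof -
  let ?p = "placement A (R0, R1)" and ?\<pi> = "lattice_vector e R0 R1"
  have T: "rotation_matrix (- R0)" "rotation_matrix (- R1)" "sum_list (period_vectors e R0 R1) = 0"
    "span (set (period_vectors e R0 R1)) = UNIV"
    using R [unfolded not_degenerate_iff] by (simp_all add: quartz_T_def)
  have moves: "moves_tetrahedra R0 R1 ?p"
    using moves_tetrahedra_placement T(3) by (simp add: e)
  have add: "Modules.additive ?\<pi>"
    by (simp add: Modules.additive_def lattice_vector_gamma)
  have "span (range ?\<pi>) = UNIV"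
    unfolding span_range_additive_period [OF add] lattice_vector_gamma lattice_vector_gamma4 [OF T(3)]
      set_period_vectors [symmetric] by (rule T)
  moreover have "?p (translate g v) = ?p v + ?\<pi> g" for g v
    by (simp add: placement_def translate_def case_prod_beta lattice_vector_gamma e)
  ultimately have per: "periodic_placement translate ?p"
    using add unfolding periodic_placement_def by blast
  have A': "dist (A i) (A j) = a" if "i < 4" "j < 4" "i \<noteq> j" for i j
    using A that by (simp add: regular_tetrahedron_def)
  have orth: "orthogonal_matrix R" if "rotation_matrix (- R)" for R :: "real ^ 3 ^ 3"
    using that by (auto simp: rotation_matrix_def orthogonal_matrix_3)
  have dist_moved: "dist (x + R *v (A i - y)) (x + R *v (A j - y)) = dist (A i) (A j)"
    if "rotation_matrix (- R)" for R x y i j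
    using orthogonal_matrix_dist [OF orth [OF that], of x "A i - y" "A j - y"] by (simp add: dist_norm)
  have "dist (?p (t ! i)) (?p (t ! j)) = a"
    if "t \<in> {tetA, tetB, tetC}" "i < 4" "j < 4" "t ! i \<noteq> t ! j" for t i j
  proof -
    have "dist (?p (t ! i)) (?p (t ! j)) = dist (A i) (A j)"
      using that moves dist_moved T(1,2)
      by (auto simp: placement_tetA moves_tetrahedra_def)
    moreover have "i \<noteq> j" using that by auto
    ultimately show ?thesis using A' that by simp
  qed
  then have "\<forall>u v. {u, v} \<in> quartz_bars \<longrightarrow> dist (?p u) (?p v) = a"
    unfolding bars_of_length_iff [OF per] by blast
  with per moves T(1,2) show ?thesis
    unfolding quartz_placements_def by blast
qed

text \<open>The identifications \<open>B\<^sub>3 = \<gamma>\<^sub>1 C\<^sub>2\<close>, \<open>A\<^sub>3 = \<gamma>\<^sub>2 C\<^sub>3\<close>, \<open>B\<^sub>2 = \<gamma>\<^sub>3 A\<^sub>2\<close>, \<open>C\<^sub>0 = \<gamma>\<^sub>4 B\<^sub>1\<close> force the translations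
  by the generators to be the period vectors.  Additivity then yields the zero-sum relation, and the
  spanning condition yields nondegeneracy.\<close>

lemma placement_unique:
  assumes e: "e = (\<lambda>i. A i - A 0)" and q: "periodic_placement translate q"
    and qA: "\<And>i. i < 4 \<Longrightarrow> q (tetA ! i) = A i"
    and R: "rotation_matrix (- R0)" "rotation_matrix (- R1)" "moves_tetrahedra R0 R1 q"
  shows "(R0, R1) \<in> quartz_T e - quartz_degenerate e" "q = placement A (R0, R1)"
proof -
  obtain \<pi> where \<pi>: "Modules.additive \<pi>" "span (range \<pi>) = UNIV" "\<And>g v. q (translate g v) = q v + \<pi> g"
    using q unfolding periodic_placement_def by blast
  interpret Modules.additive \<pi> by (rule \<pi>(1))
  have q_eq: "q (v, g) = q (v, 0) + \<pi> g" for v g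
    using \<pi>(3) [of g "(v, 0)"] by (simp add: translate_def)
  have a: "q (OA0, 0) = A 0" "q (OA1, 0) = A 1" "q (OA2, 0) = A 2" "q (OA3, 0) = A 3"
    using qA [of 0] qA [of 1] qA [of 2] qA [of 3] unfolding tet_nth by simp_all
  have m: "q (OB1, 0) = A 0 + R0 *v (A 1 - A 0)" "A 2 + \<pi> gamma3 = A 0 + R0 *v (A 2 - A 0)"
    "q (OC2, 0) + \<pi> gamma1 = A 0 + R0 *v (A 3 - A 0)"
    "q (OB1, 0) + \<pi> gamma4 = A 1 + R1 *v (A 0 - A 1)" "q (OC2, 0) = A 1 + R1 *v (A 2 - A 1)"
    "A 3 + - \<pi> gamma2 = A 1 + R1 *v (A 3 - A 1)"
    using R(3) unfolding moves_tetrahedra_def All_less_4 tet_nth q_eq [of OA2 gamma3]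
      q_eq [of OC2 gamma1] q_eq [of OB1 gamma4] q_eq [of OA3 "- gamma2"] minus a
    by blast+
  have "\<pi> gamma1 = A 0 + R0 *v (A 3 - A 0) - (A 1 + R1 *v (A 2 - A 1))"
    "\<pi> gamma2 = A 3 - (A 1 + R1 *v (A 3 - A 1))"
    "\<pi> gamma3 = A 0 + R0 *v (A 2 - A 0) - A 2"
    "\<pi> gamma4 = A 1 + R1 *v (A 0 - A 1) - (A 0 + R0 *v (A 1 - A 0))"
    using m(2,6) m(3) [unfolded m(5)] m(4) [unfolded m(1)] by (simp_all add: algebra_simps)
  then have \<pi>_eq: "\<pi> gamma1 = period_vectors e R0 R1 ! 0" "\<pi> gamma2 = period_vectors e R0 R1 ! 1"
    "\<pi> gamma3 = period_vectors e R0 R1 ! 2" "\<pi> gamma4 = period_vectors e R0 R1 ! 3"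
    by (simp_all add: period_vectors_def e eval_nat_numeral algebra_simps)
  have "sum_list (period_vectors e R0 R1) = \<pi> gamma1 + \<pi> gamma2 + \<pi> gamma3 + \<pi> gamma4"
    unfolding \<pi>_eq by (rule sum_list_period_vectors_nth)
  also have "\<dots> = 0"
    by (simp only: gamma4_def add minus right_minus)
  finally have "(R0, R1) \<in> quartz_T e"
    using R(1,2) by (simp add: quartz_T_def)
  moreover have "span (set (period_vectors e R0 R1)) = UNIV"
    using \<pi>(2) unfolding span_range_additive_period [OF \<pi>(1)] \<pi>_eq set_period_vectors .
  ultimately show "(R0, R1) \<in> quartz_T e - quartz_degenerate e"
    unfolding not_degenerate_iff ..
  have "\<pi> g = lattice_vector e R0 R1 g" for g
    unfolding additive_period_eq [OF \<pi>(1), of g] \<pi>_eq lattice_vector_def ..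
  moreover have "q (v, 0) = orbit_position A R0 R1 v" for v
    by (cases v) (simp_all add: a m)
  ultimately have "q (v, g) = placement A (R0, R1) (v, g)" for v g
    unfolding q_eq [of v g] by (simp add: placement_def e)
  then show "q = placement A (R0, R1)" by auto
qed

section \<open>Recovering the orientations from a placement\<close>

text \<open>Let \<open>F\<close> and \<open>P\<close> be the cube frames of \<open>A\<close> and of the first tetrahedron of \<open>p\<close>.  The motion taking the
  latter tetrahedron to \<open>A\<close> has linear part \<open>M = F P\<^sup>T\<close>.  If \<open>R\<close> moves the first tetrahedron to one with
  frame \<open>G\<close>, then \<open>R = G P\<^sup>T\<close>, and \<open>M R M\<^sup>T = F P\<^sup>T G F\<^sup>T\<close> is the formula used here.\<close>

definition relative_orientations ::
    "real \<Rightarrow> (nat \<Rightarrow> real ^ 3) \<Rightarrow> (quartz_vertex \<Rightarrow> real ^ 3) \<Rightarrow> (real ^ 3 ^ 3) \<times> (real ^ 3 ^ 3)" where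
  "relative_orientations a A p =
     (let F = cube_frame a A; P = transpose (cube_frame a (\<lambda>i. p (tetA ! i))) in
      (F ** P ** cube_frame a (\<lambda>i. p (tetB ! i)) ** transpose F,
       F ** P ** cube_frame a (\<lambda>i. p (tetC ! i)) ** transpose F))"

lemma relative_orientations_congruent:
  assumes "(p, q) \<in> congruence"
  shows "relative_orientations a A p = relative_orientations a A q"
proof -
  obtain t M where M: "orthogonal_matrix M" and q: "\<And>v. q v = t + M *v p v"
    using assms unfolding congruence_iff_affine by blast
  have frame: "cube_frame a (\<lambda>i. q (T i)) = M ** cube_frame a (\<lambda>i. p (T i))" for T :: "nat \<Rightarrow> _"
    by (rule cube_frame_affine [where y = t and x = 0]) (simp add: q)
  have "transpose (M ** P) ** (M ** Q) = transpose P ** Q" for P Q :: "real ^ 3 ^ 3"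
  proof -
    have "transpose (M ** P) ** (M ** Q) = transpose P ** (transpose M ** M) ** Q"
      by (simp only: matrix_transpose_mul matrix_mul_assoc)
    then show ?thesis
      using M by (simp add: orthogonal_matrix_def)
  qed
  then show ?thesis
    by (simp add: relative_orientations_def Let_def frame flip: matrix_mul_assoc)
qed

lemma relative_orientations_eq:
  assumes A: "regular_tetrahedron a A" and pA: "\<And>i. i < 4 \<Longrightarrow> p (tetA ! i) = A i"
    and R: "moves_tetrahedra R0 R1 p"
  shows "relative_orientations a A p = (R0, R1)"
proof -
  let ?F = "cube_frame a A"
  have F: "orthogonal_matrix ?F"
    by (rule orthogonal_matrix_cube_frame [OF A])
  have pF: "cube_frame a (\<lambda>i. p (tetA ! i)) = ?F"
    using cube_frame_affine [of "\<lambda>i. p (tetA ! i)" 0 "mat 1" A 0 a] pA by simp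
  have "?F ** transpose ?F ** (R ** ?F) ** transpose ?F = R" for R
  proof -
    have "?F ** transpose ?F ** (R ** ?F) ** transpose ?F = (?F ** transpose ?F) ** R ** (?F ** transpose ?F)"
      by (simp only: matrix_mul_assoc)
    then show ?thesis
      using F by (simp add: orthogonal_matrix_def)
  qed
  then show ?thesis
    by (simp only: relative_orientations_def Let_def pF moves_tetrahedra_cube_frame [OF R])
qed

lemma relative_orientations_placement:
  assumes "regular_tetrahedron a A" "(R0, R1) \<in> quartz_T (\<lambda>i. A i - A 0)"
  shows "relative_orientations a A (placement A (R0, R1)) = (R0, R1)"
  using assms
  by (intro relative_orientations_eq moves_tetrahedra_placement)
    (auto simp: placement_tetA quartz_T_def)

text \<open>The motion \<open>x \<mapsto> A\<^sub>0 + F P\<^sup>T (x - p A\<^sub>0)\<close> carries the first tetrahedron of \<open>p\<close> to \<open>A\<close>, and the moved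
  placement is covered by \<open>placement_unique\<close>.\<close>

lemma congruent_to_placement:
  assumes A: "regular_tetrahedron a A" and e: "e = (\<lambda>i. A i - A 0)" and p: "p \<in> quartz_placements a"
  shows "relative_orientations a A p \<in> quartz_T e - quartz_degenerate e"
    "(p, placement A (relative_orientations a A p)) \<in> congruence"
proof -
  let ?F = "cube_frame a A" and ?P = "cube_frame a (\<lambda>i. p (tetA ! i))"
  have a: "a > 0" using A by (simp add: regular_tetrahedron_def)
  have F: "orthogonal_matrix ?F" and P: "orthogonal_matrix ?P"
    using orthogonal_matrix_cube_frame A regular_tetrahedron_placement [OF a p] by blast+
  \<comment> \<open>linear part of the motion that takes the first tetrahedron of \<open>p\<close> to \<open>A\<close>\<close>
  define M where "M = ?F ** transpose ?P"
  have M: "orthogonal_matrix M"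
    unfolding M_def using F P by (simp add: orthogonal_matrix_mul)
  have MP: "M ** ?P = ?F"
    unfolding M_def using P by (simp add: orthogonal_matrix_def flip: matrix_mul_assoc)
  define t where "t = A 0 - M *v p (tetA ! 0)"
  define q where "q v = t + M *v p v" for v
  have pq: "(p, q) \<in> congruence"
    unfolding congruence_iff_affine using M q_def by blast
  have qA: "q (tetA ! i) = A i" if "i < 4" for i
  proof -
    have "q (tetA ! i) = A 0 + M *v (p (tetA ! i) - p (tetA ! 0))"
      by (simp add: q_def t_def matrix_vector_mult_diff_distrib)
    also have "\<dots> = A 0 + ?F *v edge_coordinates a i"
      unfolding edge_eq_cube_frame [OF a that, of "\<lambda>i. p (tetA ! i)"] matrix_vector_mul_assoc MP ..
    also have "\<dots> = A i"
      by (simp flip: edge_eq_cube_frame [OF a that])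
    finally show ?thesis .
  qed
  have "q \<in> quartz_placements a"
    using quartz_placements_congruent [OF p pq] .
  then obtain R0 R1 where R: "rotation_matrix (- R0)" "rotation_matrix (- R1)" "moves_tetrahedra R0 R1 q"
    and per: "periodic_placement translate q"
    unfolding quartz_placements_def by blast
  have "relative_orientations a A p = (R0, R1)"
    using relative_orientations_congruent [OF pq] relative_orientations_eq [OF A qA R(3)] by simp
  with placement_unique [OF e per qA R] pq
  show "relative_orientations a A p \<in> quartz_T e - quartz_degenerate e"
    "(p, placement A (relative_orientations a A p)) \<in> congruence"
    by simp_all
qed

section \<open>The quotient topology\<close>

lemma continuous_on_matrix_mult:
  fixes f :: "'a::topological_space \<Rightarrow> real ^ 'n ^ 'm" and g :: "'a \<Rightarrow> real ^ 'k ^ 'n"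
  assumes "continuous_on S f" "continuous_on S g"
  shows "continuous_on S (\<lambda>x. f x ** g x)"
  unfolding matrix_matrix_mult_def using assms by (intro continuous_intros)

lemma continuous_on_transpose:
  fixes f :: "'a::topological_space \<Rightarrow> real ^ 'n ^ 'm"
  assumes "continuous_on S f"
  shows "continuous_on S (\<lambda>x. transpose (f x))"
  unfolding transpose_def using assms by (intro continuous_intros)

lemma continuous_on_matrix_vector_mult:
  fixes f :: "'a::topological_space \<Rightarrow> real ^ 'n ^ 'm"
  assumes "continuous_on S f"
  shows "continuous_on S (\<lambda>x. f x *v v)"
  unfolding matrix_vector_mult_def using assms by (intro continuous_intros)

lemma continuous_on_cube_frame:
  assumes "\<And>i. continuous_on S (\<lambda>x. X x i)"
  shows "continuous_on S (\<lambda>x. cube_frame a (X x))"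
proof -
  have "continuous_on S (\<lambda>x. cube_axis a (X x) j)" for j
    unfolding cube_axis_def
    by (cases "j = 1"; cases "j = 2"; simp) (intro continuous_intros assms)+
  then show ?thesis
    unfolding cube_frame_def by (intro continuous_intros)
qed

lemma continuous_on_relative_orientations: "continuous_on S (relative_orientations a A)"
proof -
  have "continuous_on S (\<lambda>p::quartz_vertex \<Rightarrow> real ^ 3. p v)" for v
    by (rule continuous_on_subset [OF continuous_on_product_coordinates subset_UNIV])
  then have frame: "continuous_on S (\<lambda>p. cube_frame a (\<lambda>i. p (T i)))" for T :: "nat \<Rightarrow> quartz_vertex"
    by (rule continuous_on_cube_frame)
  show ?thesis
    unfolding relative_orientations_def [abs_def] Let_def
    by (rule continuous_on_Pair continuous_on_matrix_mult continuous_on_transpose frame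
        continuous_on_const)+
qed

lemma continuous_on_placement: "continuous_on S (placement A)"
proof (rule continuous_on_coordinatewise_then_product)
  fix x :: quartz_vertex
  obtain v g where x: "x = (v, g)" by (cases x)
  have orbit: "continuous_on S (\<lambda>R. orbit_position A (fst R) (snd R) v)"
    by (cases v) (auto intro!: continuous_intros continuous_on_matrix_vector_mult)
  have "continuous_on S (\<lambda>R. period_vectors e (fst R) (snd R) ! i)" if "i < 3" for e and i :: nat
  proof -
    have "i = 0 \<or> i = 1 \<or> i = 2" using that by auto
    then show ?thesis
      by (auto simp: period_vectors_def intro!: continuous_intros continuous_on_matrix_vector_mult)
  qed
  then have "continuous_on S (\<lambda>R. lattice_vector e (fst R) (snd R) g)" for e
    unfolding lattice_vector_def by (intro continuous_intros) simp_all
  with orbit show "continuous_on S (\<lambda>R. placement A R x)"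
    unfolding placement_def x by (simp add: case_prod_beta continuous_on_add)
qed

lemma istopology_quotient:
  fixes r :: "'a::topological_space rel"
  assumes "equiv UNIV r"
  shows "istopology (\<lambda>W. W \<subseteq> Q // r \<and> openin (top_of_set Q) (\<Union>W))"
  unfolding istopology_def
proof (intro conjI allI impI)
  fix V W assume V: "V \<subseteq> Q // r \<and> openin (top_of_set Q) (\<Union>V)"
    and W: "W \<subseteq> Q // r \<and> openin (top_of_set Q) (\<Union>W)"
  show "V \<inter> W \<subseteq> Q // r" using V by blast
  have "Q // r \<subseteq> UNIV // r" by (auto simp: quotient_def)
  with V W have "C = D" if "C \<in> V" "D \<in> W" "x \<in> C" "x \<in> D" for C D x
    using quotient_disj [OF assms, of C D] that by blast
  then have "\<Union>(V \<inter> W) = \<Union>V \<inter> \<Union>W" by blast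
  with V W show "openin (top_of_set Q) (\<Union>(V \<inter> W))" by (simp add: openin_Int)
next
  fix K assume K: "\<forall>W\<in>K. W \<subseteq> Q // r \<and> openin (top_of_set Q) (\<Union>W)"
  then show "\<Union>K \<subseteq> Q // r" by blast
  have "\<Union>(\<Union>K) = (\<Union>W\<in>K. \<Union>W)" by blast
  with K show "openin (top_of_set Q) (\<Union>(\<Union>K))" by auto
qed

text \<open>The invariant \<open>n\<close> factors through the quotient and inverts the map induced by the section \<open>s\<close>.
  Openness of that map is continuity of \<open>n\<close>: the union of the classes of \<open>s b\<close> with \<open>b\<close> in \<open>V\<close> is the
  preimage of \<open>V\<close> under \<open>n\<close>.\<close>

lemma homeomorphic_map_quotient_section:
  fixes r :: "'a::topological_space rel" and s :: "'b::topological_space \<Rightarrow> 'a"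
  assumes r: "equiv UNIV r" and Q: "\<And>x y. x \<in> Q \<Longrightarrow> (x, y) \<in> r \<Longrightarrow> y \<in> Q"
    and s: "continuous_on B s" "s \<in> B \<rightarrow> Q" and n: "continuous_on Q n" "n \<in> Q \<rightarrow> B"
    and ns: "\<And>b. b \<in> B \<Longrightarrow> n (s b) = b" and sn: "\<And>x. x \<in> Q \<Longrightarrow> (x, s (n x)) \<in> r"
    and inv: "\<And>x y. (x, y) \<in> r \<Longrightarrow> n x = n y"
  shows "homeomorphic_map (top_of_set B)
    (topology (\<lambda>W. W \<subseteq> Q // r \<and> openin (top_of_set Q) (\<Union>W))) (\<lambda>b. r `` {s b})"
proof -
  let ?X = "topology (\<lambda>W. W \<subseteq> Q // r \<and> openin (top_of_set Q) (\<Union>W))" and ?h = "\<lambda>b. r `` {s b}"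
  have op: "openin ?X W \<longleftrightarrow> W \<subseteq> Q // r \<and> openin (top_of_set Q) (\<Union>W)" for W
    by (simp add: topology_inverse' [OF istopology_quotient [OF r]])
  have refl: "(x, x) \<in> r" for x
    using r by (auto simp: equiv_def refl_on_def)
  have class_eq: "r `` {y} = r `` {x}" if "(x, y) \<in> r" for x y
    using equiv_class_eq [OF r that] by simp
  have "\<Union>(Q // r) = Q"
    using Q refl by (auto simp: quotient_def)
  then have top: "topspace ?X = Q // r"
    using op [of "Q // r"] op by (auto simp: topspace_def)
  have surj: "?h ` B = Q // r"
  proof (intro equalityI subsetI)
    fix C assume "C \<in> Q // r"
    then obtain x where x: "x \<in> Q" "C = r `` {x}" by (auto simp: quotient_def)
    then have "C = ?h (n x)" "n x \<in> B" using class_eq [OF sn [OF x(1)]] n by auto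
    then show "C \<in> ?h ` B" by blast
  qed (use s in \<open>auto simp: quotient_def\<close>)
  have inj: "inj_on ?h B"
  proof (rule inj_onI)
    fix b c assume bc: "b \<in> B" "c \<in> B" "?h b = ?h c"
    then have "(s b, s c) \<in> r" using refl by blast
    with inv ns bc show "b = c" by metis
  qed
  have cont: "continuous_map (top_of_set B) ?X ?h"
    unfolding continuous_map_def
  proof (intro conjI allI impI)
    show "?h \<in> topspace (top_of_set B) \<rightarrow> topspace ?X"
      using surj by (auto simp: top)
    fix W assume "openin ?X W"
    then have W: "W \<subseteq> Q // r" "openin (top_of_set Q) (\<Union>W)" by (simp_all add: op)
    \<comment> \<open>a class belongs to \<open>W\<close> as soon as one of its elements lies in a member of \<open>W\<close>\<close>
    have "?h b \<in> W \<longleftrightarrow> s b \<in> \<Union>W" for b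
    proof
      assume "s b \<in> \<Union>W"
      then obtain C where C: "C \<in> W" "s b \<in> C" by blast
      with W obtain x where "C = r `` {x}" by (auto simp: quotient_def)
      with C class_eq [of x "s b"] show "?h b \<in> W" by auto
    qed (use refl in blast)
    then have "{b \<in> topspace (top_of_set B). ?h b \<in> W} = B \<inter> s -` \<Union>W" by auto
    then show "openin (top_of_set B) {b \<in> topspace (top_of_set B). ?h b \<in> W}"
      using continuous_openin_preimage [OF s W(2)] by simp
  qed
  have opn: "open_map (top_of_set B) ?X ?h"
    unfolding open_map_def op
  proof (intro allI impI conjI)
    fix V assume V: "openin (top_of_set B) V"
    then have VB: "V \<subseteq> B" using openin_imp_subset by blast
    with surj show "?h ` V \<subseteq> Q // r" by blast
    have "\<Union>(?h ` V) = Q \<inter> n -` V"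
    proof (intro equalityI subsetI)
      fix x assume "x \<in> \<Union>(?h ` V)"
      then obtain b where b: "b \<in> V" "(s b, x) \<in> r" by blast
      with VB s Q have "x \<in> Q" by blast
      moreover have "n x = b" using inv [OF b(2)] ns b(1) VB by auto
      ultimately show "x \<in> Q \<inter> n -` V" using b(1) by simp
    next
      fix x assume "x \<in> Q \<inter> n -` V"
      then show "x \<in> \<Union>(?h ` V)" using class_eq [OF sn, of x] refl by blast
    qed
    then show "openin (top_of_set Q) (\<Union>(?h ` V))"
      using continuous_openin_preimage [OF n V] by simp
  qed
  show ?thesis
    using bijective_open_imp_homeomorphic_map [OF cont opn] surj inj by (simp add: top)
qed

section \<open>The deformation space of the ideal quartz framework\<close>

theorem theorem1:
  fixes a :: real and A e :: "nat \<Rightarrow> real ^ 3"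
  assumes "regular_tetrahedron a A"
    and "e = (\<lambda>i. A i - A 0)"
  shows "diffeomorphic (quartz_T e)
           (sphere (0::complex) 1 \<times> sphere (0::complex) 1 \<times> sphere (0::complex) 1) \<and>
         (\<exists>h. homeomorphic_map (top_of_set (quartz_T e - quartz_degenerate e))
                (quartz_deformation_space a) h \<and>
              (\<forall>(R0, R1) \<in> quartz_T e - quartz_degenerate e.
                 \<exists>p \<in> h (R0, R1). (\<forall>i<4. p (tetA ! i) = A i) \<and> moves_tetrahedra R0 R1 p))"
proof (intro conjI exI)
  let ?B = "quartz_T e - quartz_degenerate e" and ?h = "\<lambda>R. congruence `` {placement A R}"
  note A = assms
  show "diffeomorphic (quartz_T e) torus3"
    by (rule diffeomorphic_quartz_T_torus [OF A])
  show "homeomorphic_map (top_of_set ?B) (quartz_deformation_space a) ?h"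
    unfolding quartz_deformation_space_def
  proof (rule homeomorphic_map_quotient_section [where n = "relative_orientations a A"])
    show "placement A \<in> ?B \<rightarrow> quartz_placements a"
      using placement_in_quartz_placements [OF A] by auto
    show "relative_orientations a A \<in> quartz_placements a \<rightarrow> ?B"
      using congruent_to_placement(1) [OF A] by blast
    show "relative_orientations a A (placement A R) = R" if "R \<in> ?B" for R
      using relative_orientations_placement [OF A(1)] that by (cases R) (auto simp: A(2))
  qed (use equiv_congruence quartz_placements_congruent continuous_on_placement
      continuous_on_relative_orientations congruent_to_placement(2) [OF A]
      relative_orientations_congruent in blast)+
  show "\<forall>(R0, R1) \<in> ?B. \<exists>p \<in> ?h (R0, R1). (\<forall>i<4. p (tetA ! i) = A i) \<and> moves_tetrahedra R0 R1 p"
  proof safe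
    fix R0 R1 assume "(R0, R1) \<in> quartz_T e"
    then have "moves_tetrahedra R0 R1 (placement A (R0, R1))"
      using moves_tetrahedra_placement by (auto simp: quartz_T_def A(2))
    moreover have "placement A (R0, R1) \<in> ?h (R0, R1)"
      using equiv_class_self [OF equiv_congruence] by blast
    ultimately show "\<exists>p \<in> ?h (R0, R1). (\<forall>i<4. p (tetA ! i) = A i) \<and> moves_tetrahedra R0 R1 p"
      using placement_tetA by blast
  qed
qed

end
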